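(* Fix $k\in\mathbb{N}_0$ and $A\ge 0$. (Charlier) Let $\mu>0$, let $\{C_n^{\mu,A}\}_{n\ge0}$ be the mass-modified monic Charlier polynomials, and let $\theta_n(z)=(-1)^n/\Gamma(n-z)$. Then, locally uniformly for $z\in\mathbb{C}$, $$\lim_{n\to\infty}\theta_n(z)\,\Delta^kC_n^{\mu,A}(z)=(-1)^k\varphi_C(z),\qquad \varphi_C(z)=\frac{e^{\mu}}{\Gamma(-z)}.$$ (Meixner) Let $\gamma>0$, $0<\mu<1$, let $\{M_n^{\gamma,\mu,A}\}_{n\ge0}$ be the mass-modified monic Meixner polynomials, and let $\theta_n(z)=(\mu-1)^n/\Gamma(n-z)$. Then, locally uniformly for $z\in\mathbb{C}$, $$\lim_{n\to\infty}\theta_n(z)\,\Delta^kM_n^{\gamma,\mu,A}(z)=(-1)^k\varphi_M(z),\qquad \varphi_M(z)=\frac{1}{(1-\mu)^{\gamma+z}\,\Gamma(-z)}.$$ In particular, for $k=0$, $\theta_n(z)C_n^{\mu,A}(z)\to\varphi_C(z)$ and $\theta_n(z)M_n^{\gamma,\mu,A}(z)\to\varphi_M(z)$ (with the respective $\theta_n$), so that for each fixed $A\ge0$ the modified polynomials have the same limits as the classical ones (the case $A=0$).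
   Context: $\mathbb{N}_0=\{0,1,2,\dots\}$. Difference operator: $\Delta f(x)=f(x+1)-f(x)$, $\Delta^k=\Delta\circ\Delta^{k-1}$, $\Delta^0=\mathrm{Id}$. Classical families: the monic polynomials $P_n$ are determined by $P_{-1}=0$, $P_0=1$ and $xP_n(x)=P_{n+1}(x)+\alpha_nP_n(x)+\beta_nP_{n-1}(x)$ for $n\ge 0$. Their classical inner product $\langle\cdot,\cdot\rangle$ on the space of real polynomials satisfies $\langle P_m,P_n\rangle=d_n^2\delta_{mn}$. The data are: - monic Charlier $C_n^{\mu}$, $\mu>0$: $\alpha_n=n+\mu$, $\beta_n=n\mu$, $d_n^2=n!\,\mu^n$; equivalently $\langle p,q\rangle=\sum_{x=0}^{\infty}p(x)q(x)\,e^{-\mu}\mu^x/x!$; - monic Meixner $M_n^{\gamma,\mu}$, $\gamma>0$, $0<\mu<1$: $\alpha_n=\dfrac{n(1+\mu)+\mu\gamma}{1-\mu}$, $\beta_n=\dfrac{n\mu(n-1+\gamma)}{(\mu-1)^2}$, $d_n^2=\dfrac{n!\,(\gamma)_n\,\mu^n}{(1-\mu)^{\gamma+2n}}$; equivalently $\langle p,q\rangle=\sum_{x=0}^{\infty}p(x)q(x)\,(\gamma)_x\mu^x/x!$, where $(\gamma)_n=\Gamma(\gamma+n)/\Gamma(\gamma)$. Mass-modified families: for $A\ge0$, $\{C_n^{\mu,A}\}$ (respectively $\{M_n^{\gamma,\mu,A}\}$) is the sequence of monic polynomials ($\deg=n$) orthogonal with respect to $\langle p,q\rangle_A=\langle p,q\rangle+A\,p(0)q(0)$,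 with $\langle\cdot,\cdot\rangle$ the Charlier (respectively Meixner) inner product above. $1/\Gamma$ denotes the entire reciprocal Gamma function (equal to $0$ at nonpositive integers). The power $(1-\mu)^{w}$ means $\exp(w\log(1-\mu))$ with the real logarithm. "Locally uniformly" means uniformly on compact subsets of $\mathbb{C}$. *)

theory Defs
  imports "HOL-Analysis.Analysis" "HOL-Computational_Algebra.Polynomial"
begin

definition forward_diff :: "('a::ring_1 \<Rightarrow> 'a) \<Rightarrow> 'a \<Rightarrow> 'a"
  where "forward_diff f = (\<lambda>x. f (x + 1) - f x)"

abbreviation cpoly :: "real poly \<Rightarrow> complex \<Rightarrow> complex"
  where "cpoly p \<equiv> poly (map_poly complex_of_real p)"

definition locally_uniform_limit ::
    "(nat \<Rightarrow> complex \<Rightarrow> complex) \<Rightarrow> (complex \<Rightarrow> complex) \<Rightarrow> bool"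
  where "locally_uniform_limit f l \<longleftrightarrow> (\<forall>K. compact K \<longrightarrow> uniform_limit K f l sequentially)"

text \<open>
  The monic solution of \<open>x P\<^sub>n = P\<^sub>n\<^sub>+\<^sub>1 + \<alpha>\<^sub>n P\<^sub>n + \<beta>\<^sub>n P\<^sub>n\<^sub>-\<^sub>1\<close> with \<open>P\<^sub>-\<^sub>1 = 0\<close>, \<open>P\<^sub>0 = 1\<close>.
  The value \<open>\<beta>\<^sub>0\<close> is irrelevant, because it multiplies \<open>P\<^sub>-\<^sub>1\<close>.
\<close>
fun monic_recurrence :: "(nat \<Rightarrow> real) \<Rightarrow> (nat \<Rightarrow> real) \<Rightarrow> nat \<Rightarrow> real poly"
  where
    "monic_recurrence \<alpha> \<beta> 0 = 1"
  | "monic_recurrence \<alpha> \<beta> (Suc 0) = [:- \<alpha> 0, 1:]"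
  | "monic_recurrence \<alpha> \<beta> (Suc (Suc n)) =
       [:- \<alpha> (Suc n), 1:] * monic_recurrence \<alpha> \<beta> (Suc n)
       - smult (\<beta> (Suc n)) (monic_recurrence \<alpha> \<beta> n)"

definition charlier :: "real \<Rightarrow> nat \<Rightarrow> real poly"
  where "charlier \<mu> = monic_recurrence (\<lambda>n. real n + \<mu>) (\<lambda>n. real n * \<mu>)"

definition meixner :: "real \<Rightarrow> real \<Rightarrow> nat \<Rightarrow> real poly"
  where "meixner \<gamma> \<mu> = monic_recurrence
    (\<lambda>n. (real n * (1 + \<mu>) + \<mu> * \<gamma>) / (1 - \<mu>))
    (\<lambda>n. real n * \<mu> * (real n - 1 + \<gamma>) / (\<mu> - 1)\<^sup>2)"

text \<open>
  The normalisation of the weights matters once a point mass is added: the Charlier weight has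
  total mass \<open>1\<close>, the Meixner weight has total mass \<open>(1 - \<mu>)\<close> to the power \<open>-\<gamma>\<close>.
\<close>
definition charlier_inner :: "real \<Rightarrow> real poly \<Rightarrow> real poly \<Rightarrow> real"
  where "charlier_inner \<mu> p q =
    (\<Sum>x::nat. poly p (real x) * poly q (real x) * (exp (- \<mu>) * \<mu> ^ x / fact x))"

definition meixner_inner :: "real \<Rightarrow> real \<Rightarrow> real poly \<Rightarrow> real poly \<Rightarrow> real"
  where "meixner_inner \<gamma> \<mu> p q =
    (\<Sum>x::nat. poly p (real x) * poly q (real x) * (pochhammer \<gamma> x * \<mu> ^ x / fact x))"

definition add_mass ::
    "real \<Rightarrow> (real poly \<Rightarrow> real poly \<Rightarrow> real) \<Rightarrow> real poly \<Rightarrow> real poly \<Rightarrow> real"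
  where "add_mass A B p q = B p q + A * poly p 0 * poly q 0"

definition monic_orthogonal :: "(real poly \<Rightarrow> real poly \<Rightarrow> real) \<Rightarrow> (nat \<Rightarrow> real poly) \<Rightarrow> bool"
  where "monic_orthogonal B P \<longleftrightarrow>
    (\<forall>n. degree (P n) = n \<and> lead_coeff (P n) = 1) \<and>
    (\<forall>m n. m \<noteq> n \<longrightarrow> B (P m) (P n) = 0)"

definition charlier_theta :: "nat \<Rightarrow> complex \<Rightarrow> complex"
  where "charlier_theta n z = (-1) ^ n * rGamma (of_nat n - z)"

definition charlier_phi :: "real \<Rightarrow> complex \<Rightarrow> complex"
  where "charlier_phi \<mu> z = of_real (exp \<mu>) * rGamma (- z)"

definition meixner_theta :: "real \<Rightarrow> nat \<Rightarrow> complex \<Rightarrow> complex"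
  where "meixner_theta \<mu> n z = of_real (\<mu> - 1) ^ n * rGamma (of_nat n - z)"

text \<open>The exponential is the power of \<open>1 - \<mu>\<close> with exponent \<open>\<gamma> + z\<close>, taken with the real logarithm.\<close>
definition meixner_phi :: "real \<Rightarrow> real \<Rightarrow> complex \<Rightarrow> complex"
  where "meixner_phi \<gamma> \<mu> z =
    rGamma (- z) / exp ((of_real \<gamma> + z) * of_real (ln (1 - \<mu>)))"

end

theory Submission
  imports Defs "HOL-Real_Asymp.Real_Asymp"
begin

text \<open>
  Both families are the case \<open>a > 0\<close>, \<open>0 \<le> b < 1\<close> of one family of monic polynomials
  \<open>P\<^sub>n(b, a; x)\<close>, orthogonal for the weight \<open>a (a + b) \<dots> (a + b (x - 1)) / x!\<close> on the natural
  numbers: Charlier is \<open>b = 0\<close>, \<open>a = \<mu>\<close> (up to the factor \<open>exp (- \<mu>)\<close>), and Meixner is \<open>b = \<mu>\<close>,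
  \<open>a = \<mu> \<gamma>\<close>. Put \<open>Q\<^sub>n = (b - 1)\<^sup>n P\<^sub>n\<close> and \<open>G\<^sub>n(z) = Q\<^sub>n(z) / \<Gamma>(n - z)\<close>; thus \<open>G\<^sub>n\<close> is
  the classical polynomial with the scaling of the theorem.

  \<^emph>\<open>The classical limit\<close> (\<open>scaled_meixner_limit\<close>). The explicit formula
  \<open>Q\<^sub>n(z) = \<Sum>\<^sub>i binomial(n, i) (- z)\<^sub>n\<^sub>-\<^sub>i (a + b z) (a + b z + b) \<dots> (a + b z + b (i - 1))\<close>
  turns \<open>G\<^sub>n(z)\<close> into \<open>1 / \<Gamma>(- z)\<close> times a sum whose terms tend to those of the binomial series of
  \<open>(1 - b) powr (- z - a / b)\<close>, or of \<open>exp a\<close> when \<open>b = 0\<close>. If \<open>Re z \<le> - 1\<close>, the quotients of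
  Gamma factors in this sum have modulus at most 1, so dominated convergence applies, uniformly on
  compact sets. No such bound is available near the nonnegative integers. Instead, the raising and
  lowering relations express \<open>G\<^sub>n\<close> at \<open>z\<close> by values of \<open>G\<close> at \<open>z - 1\<close> only, with parameters
  \<open>a + b\<close> and \<open>a + 2 b\<close> and convergent coefficients (\<open>scaled_meixner_step\<close>); by induction, uniform
  convergence spreads from the half-plane \<open>Re z \<le> - 1\<close> to all of \<open>\<complex>\<close>.

  \<^emph>\<open>The point mass\<close> (\<open>mass_modification\<close>, \<open>mass_modified_limit\<close>). The polynomials
  \<open>S(x) = P\<^sub>n\<^sub>-\<^sub>1(b, a + b; x - 1)\<close> are orthogonal for the weight multiplied by \<open>x\<close>, and a mass at \<open>0\<close>
  is invisible to multiples of \<open>x\<close>. Hence the modified polynomial is \<open>P\<^sub>n - c\<^sub>n S\<close>. The number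
  \<open>c\<^sub>n\<close> follows by testing against \<open>1\<close>, and \<open>\<bar>c\<^sub>n\<bar>\<close> is at most a constant times \<open>n\<close> times the
  weight at \<open>n\<close>, which tends to \<open>0\<close>. Since \<open>S\<close>, multiplied by \<open>(b - 1)\<^sup>n / \<Gamma>(n - z)\<close>, is
  \<open>b - 1\<close> times \<open>G\<^sub>n\<^sub>-\<^sub>1\<close> at \<open>z - 1\<close> with parameter \<open>a + b\<close>, it has a limit, and the correction
  disappears.

  \<^emph>\<open>Differences\<close> (\<open>scaled_forward_diff_limit\<close>). As \<open>\<Gamma>(n - z) = (n - z - 1) \<Gamma>(n - z - 1)\<close>, the
  term \<open>f\<^sub>n(z + 1)\<close> of \<open>\<Delta> f\<^sub>n(z)\<close> contributes \<open>1 / (n - z - 1)\<close> times a convergent quantity, so each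
  \<open>\<Delta>\<close> only changes the sign of the limit.
\<close>

section \<open>Uniform limits on compact sets\<close>

lemma uniform_limit_norm_diff_le:
  fixes f :: "nat \<Rightarrow> 'a \<Rightarrow> 'b::real_normed_vector"
  assumes "\<forall>\<^sub>F n in sequentially. \<forall>x\<in>K. norm (f n x - l x) \<le> e n" and "e \<longlonglongrightarrow> 0"
  shows "uniform_limit K f l sequentially"
proof (rule uniform_limitI)
  fix \<epsilon> :: real
  assume "\<epsilon> > 0"
  with assms(2) have "\<forall>\<^sub>F n in sequentially. e n < \<epsilon>"
    by (rule order_tendstoD)
  with assms(1) show "\<forall>\<^sub>F n in sequentially. \<forall>x\<in>K. dist (f n x) (l x) < \<epsilon>"
    by eventually_elim (force simp: dist_norm)
qed

lemma uniform_limit_transform_eventually: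
  fixes f :: "'i \<Rightarrow> 'a \<Rightarrow> 'b::metric_space"
  assumes "uniform_limit K f l F" and "\<forall>\<^sub>F n in F. \<forall>x\<in>K. f n x = g n x"
    and "\<And>x. x \<in> K \<Longrightarrow> l x = m x"
  shows "uniform_limit K g m F"
  using uniform_limit_cong [THEN iffD1, OF assms(2) _ assms(1), of m] assms(3) by auto

text \<open>
  If the convergence were not uniform, a point that violates it could be chosen for infinitely many
  \<open>n\<close>; the resulting sequence of points contradicts the assumption. This reduces uniform statements
  to statements about sequences of numbers.
\<close>

lemma uniform_limit_along_sequences:
  fixes f :: "nat \<Rightarrow> 'a \<Rightarrow> 'b::real_normed_vector"
  assumes "\<And>x. (\<And>n. x n \<in> K) \<Longrightarrow> (\<lambda>n. f n (x n) - l (x n)) \<longlonglongrightarrow> 0"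
  shows "uniform_limit K f l sequentially"
proof (cases "K = {}")
  case False
  then obtain k where k: "k \<in> K" by blast
  show ?thesis
  proof (rule uniform_limitI)
    fix \<epsilon> :: real
    assume "\<epsilon> > 0"
    define bad where "bad n y \<longleftrightarrow> y \<in> K \<and> \<not> dist (f n y) (l y) < \<epsilon>" for n y
    define x where "x n = (if \<exists>y. bad n y then SOME y. bad n y else k)" for n
    have x_bad: "bad n (x n)" if "bad n y" for n y
      using that someI [of "bad n" y] by (auto simp: x_def)
    have "x n \<in> K" for n
      using x_bad [of n] k by (cases "\<exists>y. bad n y") (auto simp: bad_def x_def)
    then have "(\<lambda>n. f n (x n) - l (x n)) \<longlonglongrightarrow> 0"
      by (rule assms)
    then have "\<forall>\<^sub>F n in sequentially. dist (f n (x n) - l (x n)) 0 < \<epsilon>"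
      using \<open>\<epsilon> > 0\<close> by (rule tendstoD)
    then show "\<forall>\<^sub>F n in sequentially. \<forall>y\<in>K. dist (f n y) (l y) < \<epsilon>"
    proof eventually_elim
      case (elim n)
      then have "\<not> bad n (x n)"
        by (simp add: bad_def dist_norm)
      then show ?case
        using x_bad [of n] by (auto simp: bad_def)
    qed
  qed
qed simp

lemma uniform_limit_apply_sequence:
  fixes f :: "nat \<Rightarrow> 'a \<Rightarrow> 'b::real_normed_vector"
  assumes "uniform_limit K f l sequentially" and x: "\<And>n. x n \<in> K"
  shows "(\<lambda>n. f n (x n) - l (x n)) \<longlonglongrightarrow> 0"
proof (rule tendstoI)
  fix \<epsilon> :: real
  assume "\<epsilon> > 0"
  with assms(1) have "\<forall>\<^sub>F n in sequentially. \<forall>y\<in>K. dist (f n y) (l y) < \<epsilon>"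
    by (rule uniform_limitD)
  then show "\<forall>\<^sub>F n in sequentially. dist (f n (x n) - l (x n)) 0 < \<epsilon>"
    by eventually_elim (use x in \<open>auto simp: dist_norm\<close>)
qed

text \<open>
  A locally uniform version of Tannery's theorem. Along any sequence of points it is Tannery's
  theorem itself, applied to the differences \<open>f i n - g i\<close> with the bound \<open>2 * M i\<close>.
\<close>

lemma uniform_limit_suminf_dominated:
  fixes f :: "nat \<Rightarrow> nat \<Rightarrow> 'a \<Rightarrow> 'b::{real_normed_algebra, banach}"
  assumes lim: "\<And>i. uniform_limit K (f i) (g i) sequentially"
    and bound: "\<And>i n x. x \<in> K \<Longrightarrow> norm (f i n x) \<le> M i"
    and M: "summable M"
  shows "uniform_limit K (\<lambda>n x. \<Sum>i. f i n x) (\<lambda>x. \<Sum>i. g i x) sequentially"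
proof (rule uniform_limit_along_sequences)
  fix x :: "nat \<Rightarrow> 'a"
  assume x: "\<And>n. x n \<in> K"
  have g_bound: "norm (g i y) \<le> M i" if "y \<in> K" for i y
  proof (rule Lim_norm_ubound)
    show "(\<lambda>n. f i n y) \<longlonglongrightarrow> g i y"
      using lim that by (rule tendsto_uniform_limitI)
  qed (use bound that in auto)
  have summable_fg: "summable (\<lambda>i. f i n y)" "summable (\<lambda>i. g i y)" if "y \<in> K" for n y
    using bound g_bound that by (auto intro: summable_comparison_test' [OF M])
  have "(\<lambda>n. \<Sum>i. f i n (x n) - g i (x n)) \<longlonglongrightarrow> (\<Sum>i. 0)"
  proof (rule conjunct2 [OF conjunct2 [OF tannerys_theorem]])
    show "(\<lambda>n. f i n (x n) - g i (x n)) \<longlonglongrightarrow> 0" for i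
      using lim x by (rule uniform_limit_apply_sequence)
    have "norm (f i n (x n) - g i (x n)) \<le> 2 * M i" for i n
      using norm_triangle_ineq4 [of "f i n (x n)" "g i (x n)"] bound [OF x, of i n n]
        g_bound [OF x, of i n] by linarith
    then show "\<forall>\<^sub>F (i, n) in at_top \<times>\<^sub>F sequentially. norm (f i n (x n) - g i (x n)) \<le> 2 * M i"
      by (intro always_eventually) auto
    show "summable (\<lambda>i. 2 * M i)"
      using M by (rule summable_mult)
  qed simp
  then show "(\<lambda>n. (\<Sum>i. f i n (x n)) - (\<Sum>i. g i (x n))) \<longlonglongrightarrow> 0"
    using summable_fg x by (simp add: suminf_diff)
qed

lemma uniform_limit_mult_compact:
  fixes l m :: "complex \<Rightarrow> complex"
  assumes "compact K" "continuous_on K l" "continuous_on K m"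
    and "uniform_limit K f l sequentially" "uniform_limit K g m sequentially"
  shows "uniform_limit K (\<lambda>n z. f n z * g n z) (\<lambda>z. l z * m z) sequentially"
  using assms by (intro uniform_lim_mult compact_imp_bounded compact_continuous_image)

lemma continuous_on_rGamma_compose:
  "continuous_on S f \<Longrightarrow> continuous_on S (\<lambda>z. rGamma (f z :: complex))"
  by (rule continuous_on_compose2 [OF continuous_on_rGamma [of UNIV]]) auto

lemma uniform_limit_inverse_shift:
  assumes "compact K"
  shows "uniform_limit K (\<lambda>n z. 1 / (of_nat n - z)) (\<lambda>z::complex. 0) sequentially"
proof -
  obtain R where "R > 0" and R: "\<And>z. z \<in> K \<Longrightarrow> norm z \<le> R"
    using compact_imp_bounded [OF assms] bounded_pos by blast
  show ?thesis
  proof (rule uniform_limit_norm_diff_le)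
    show "\<forall>\<^sub>F n in sequentially. \<forall>z\<in>K. norm (1 / (of_nat n - z) - 0) \<le> 1 / (real n - R)"
      using eventually_gt_at_top [of "nat \<lceil>R\<rceil>"]
    proof eventually_elim
      case (elim n)
      then have "real n > R" by linarith
      moreover have "real n - R \<le> norm (of_nat n - z)" if "z \<in> K" for z
        using norm_triangle_ineq2 [of "of_nat n" z] R [OF that] by simp
      ultimately show ?case
        by (auto simp: norm_divide intro!: frac_le)
    qed
    show "(\<lambda>n. 1 / (real n - R)) \<longlonglongrightarrow> 0"
      by real_asymp
  qed
qed

lemma eventually_of_nat_avoids_compact:
  assumes "compact K"
  shows "\<forall>\<^sub>F n in sequentially. \<forall>z\<in>K. of_nat n \<noteq> (z::complex)"
proof -
  obtain R where R: "\<And>z. z \<in> K \<Longrightarrow> norm z \<le> R"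
    using compact_imp_bounded [OF assms] unfolding bounded_iff by blast
  show ?thesis
    using eventually_gt_at_top [of "nat \<lceil>R\<rceil>"]
  proof eventually_elim
    case (elim n)
    show ?case
    proof (intro ballI notI)
      fix z
      assume "z \<in> K" "of_nat n = z"
      then have "real n \<le> R"
        using R [of z] by auto
      then show False
        using elim by linarith
    qed
  qed
qed

lemma uniform_limit_ratio_shift:
  assumes K: "compact K"
  shows "uniform_limit K (\<lambda>n z. of_nat n / (of_nat n - z)) (\<lambda>z::complex. 1) sequentially"
proof -
  have "uniform_limit K (\<lambda>n z. 1 + z * (1 / (of_nat n - z))) (\<lambda>z::complex. 1 + z * 0) sequentially"
    using K by (intro uniform_limit_add uniform_limit_const uniform_limit_mult_compact
        uniform_limit_inverse_shift continuous_intros)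
  moreover have "\<forall>\<^sub>F n in sequentially. \<forall>z\<in>K.
      1 + z * (1 / (of_nat n - z)) = of_nat n / (of_nat n - z)"
    using eventually_of_nat_avoids_compact [OF K]
    by eventually_elim (auto simp: add_divide_eq_iff)
  ultimately show ?thesis
    by (rule uniform_limit_transform_eventually) simp
qed

lemma uniform_limit_translate:
  fixes f :: "nat \<Rightarrow> complex \<Rightarrow> complex"
  assumes "locally_uniform_limit f l" "compact K"
  shows "uniform_limit K (\<lambda>n z. f n (z + c)) (\<lambda>z. l (z + c)) sequentially"
proof (rule uniform_limit_compose')
  have "compact ((\<lambda>z. z + c) ` K)"
    using assms(2) by (intro compact_continuous_image continuous_intros)
  then show "uniform_limit ((\<lambda>z. z + c) ` K) f l sequentially"
    using assms(1) unfolding locally_uniform_limit_def by blast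
qed auto

section \<open>Meixner functions and their recurrences\<close>

text \<open>
  The rising product \<open>a (a + b) \<dots> (a + b (i - 1))\<close>. It is \<open>a\<^sup>i\<close> for \<open>b = 0\<close> and \<open>b\<^sup>i (a / b)\<^sub>i\<close>
  otherwise, so that Charlier and Meixner weights become one expression without a division by \<open>b\<close>.
\<close>

definition step_pochhammer :: "'a::comm_ring_1 \<Rightarrow> 'a \<Rightarrow> nat \<Rightarrow> 'a"
  where "step_pochhammer b a i = (\<Prod>j<i. a + b * of_nat j)"

lemma step_pochhammer_0 [simp]: "step_pochhammer b a 0 = 1"
  by (simp add: step_pochhammer_def)

lemma step_pochhammer_Suc: "step_pochhammer b a (Suc i) = step_pochhammer b a i * (a + b * of_nat i)"
  by (simp add: step_pochhammer_def mult.commute)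

lemma step_pochhammer_rec: "step_pochhammer b a (Suc i) = a * step_pochhammer b (a + b) i"
  unfolding step_pochhammer_def prod.lessThan_Suc_shift by (simp add: algebra_simps)

text \<open>
  The value at \<open>x\<close> of \<open>(b - 1)\<^sup>n\<close> times the monic polynomial of degree \<open>n\<close>; for \<open>b \<noteq> 0\<close> the
  exponential generating function in \<open>t\<close> is \<open>(1 - t) powr x * (1 - b * t) powr (- x - a / b)\<close>. The
  recursion is the raising operator, which lowers the parameter from \<open>a + b\<close> to \<open>a\<close>; it is the form
  in which orthogonality is proved by summation by parts.
\<close>

fun meixner_fun :: "'a::comm_ring_1 \<Rightarrow> nat \<Rightarrow> 'a \<Rightarrow> 'a \<Rightarrow> 'a"
  where
    "meixner_fun b 0 a x = 1"
  | "meixner_fun b (Suc n) a x =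
       (a + b * x) * meixner_fun b n (a + b) x - x * meixner_fun b n (a + b) (x - 1)"

text \<open>
  Multiplication of the generating function for \<open>a + b\<close> by \<open>1 - b t\<close>.
\<close>

lemma meixner_fun_raise_parameter:
  "meixner_fun b (Suc n) a x =
     meixner_fun b (Suc n) (a + b) x - b * of_nat (Suc n) * meixner_fun b n (a + b) x"
proof (induction n arbitrary: a x)
  case 0
  show ?case by (simp add: algebra_simps)
next
  case (Suc n)
  define u where "u y = meixner_fun b (Suc n) (a + b + b) y" for y
  define v where "v y = meixner_fun b n (a + b + b) y" for y
  have lower: "meixner_fun b (Suc n) (a + b) y = u y - b * of_nat (Suc n) * v y" for y
    unfolding u_def v_def by (rule Suc.IH)
  have "meixner_fun b (Suc (Suc n)) a x =
      (a + b * x) * (u x - b * of_nat (Suc n) * v x)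
      - x * (u (x - 1) - b * of_nat (Suc n) * v (x - 1))"
    by (subst meixner_fun.simps(2)) (simp only: lower)
  also have "\<dots> = ((a + b + b * x) * u x - x * u (x - 1))
      - b * (u x - b * of_nat (Suc n) * v x)
      - b * of_nat (Suc n) * ((a + b + b * x) * v x - x * v (x - 1))"
    by (simp add: algebra_simps)
  also have "(a + b + b * x) * u x - x * u (x - 1) = meixner_fun b (Suc (Suc n)) (a + b) x"
    unfolding u_def by (subst (3) meixner_fun.simps(2)) simp
  also have "(a + b + b * x) * v x - x * v (x - 1) = meixner_fun b (Suc n) (a + b) x"
    unfolding v_def by simp
  finally show ?case
    unfolding lower [symmetric] by (simp add: algebra_simps del: meixner_fun.simps)
qed

text \<open>
  Multiplication of the generating function for \<open>a + b\<close> at \<open>x - 1\<close> by \<open>1 - t\<close>.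
\<close>

lemma meixner_fun_raise_parameter_shift:
  "meixner_fun b (Suc n) a x =
     meixner_fun b (Suc n) (a + b) (x - 1) - of_nat (Suc n) * meixner_fun b n (a + b) (x - 1)"
proof (induction n arbitrary: a x)
  case 0
  show ?case by (simp add: algebra_simps)
next
  case (Suc n)
  define u where "u y = meixner_fun b (Suc n) (a + b + b) y" for y
  define v where "v y = meixner_fun b n (a + b + b) y" for y
  have lower: "meixner_fun b (Suc n) (a + b) y = u (y - 1) - of_nat (Suc n) * v (y - 1)" for y
    unfolding u_def v_def by (rule Suc.IH)
  have v_raise: "meixner_fun b (Suc n) (a + b) (x - 1) =
      (a + b * x) * v (x - 1) - (x - 1) * v (x - 1 - 1)"
    unfolding v_def by (simp add: algebra_simps)
  have u_raise: "meixner_fun b (Suc (Suc n)) (a + b) (x - 1) =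
      (a + b * x) * u (x - 1) - (x - 1) * u (x - 1 - 1)"
    unfolding u_def by (subst meixner_fun.simps(2)) (simp add: algebra_simps del: meixner_fun.simps)
  have uv: "u (x - 1 - 1) =
      (a + b * x) * v (x - 1) - (x - 1) * v (x - 1 - 1) + of_nat (Suc n) * v (x - 1 - 1)"
    using v_raise unfolding lower by (simp add: algebra_simps)
  have "meixner_fun b (Suc (Suc n)) a x =
      (a + b * x) * (u (x - 1) - of_nat (Suc n) * v (x - 1))
      - x * (u (x - 1 - 1) - of_nat (Suc n) * v (x - 1 - 1))"
    by (subst meixner_fun.simps(2)) (simp only: lower)
  also have "\<dots> = ((a + b * x) * u (x - 1) - (x - 1) * u (x - 1 - 1))
      - of_nat (Suc (Suc n)) * ((a + b * x) * v (x - 1) - (x - 1) * v (x - 1 - 1))"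
    unfolding uv by (simp add: algebra_simps)
  finally show ?case
    unfolding u_raise v_raise .
qed

text \<open>
  The lowering operator: the two preceding relations, the second one taken at \<open>x + 1\<close>, expand
  \<open>meixner_fun b (Suc n) a\<close> at \<open>x\<close> and at \<open>x + 1\<close> in the same two functions.
\<close>

lemma meixner_fun_difference:
  "meixner_fun b (Suc n) a (x + 1) - meixner_fun b (Suc n) a x =
     (b - 1) * of_nat (Suc n) * meixner_fun b n (a + b) x"
  using meixner_fun_raise_parameter [of b n a x] meixner_fun_raise_parameter_shift [of b n a "x + 1"]
  by (simp add: algebra_simps del: meixner_fun.simps)

text \<open>
  In terms of the generating function \<open>F\<close> this is the differential equation
  \<open>(1 - t) (1 - b t) F' = ((a + b x) (1 - t) - x (1 - b t)) F\<close>. The raising recursion computes \<open>F'\<close>,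
  and each of the two factors \<open>1 - t\<close>, \<open>1 - b t\<close> returns one of the terms from \<open>a + b\<close> to \<open>a\<close>.
\<close>

lemma meixner_fun_three_term:
  "meixner_fun b (Suc (Suc n)) a x =
     (of_nat (Suc n) * (1 + b) + a - (1 - b) * x) * meixner_fun b (Suc n) a x
     - of_nat (Suc n) * (a + b * of_nat n) * meixner_fun b n a x"
proof -
  define N :: 'a where "N = of_nat (Suc n)"
  define R where "R k = meixner_fun b k (a + b) x" for k
  define T where "T k = meixner_fun b k (a + b) (x - 1)" for k
  define Q where "Q k = meixner_fun b k a x" for k
  have QR: "Q (Suc k) = R (Suc k) - b * of_nat (Suc k) * R k"
    and QT: "Q (Suc k) = T (Suc k) - of_nat (Suc k) * T k"
    and Q: "Q (Suc k) = (a + b * x) * R k - x * T k" for k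
    using meixner_fun_raise_parameter [of b k a x] meixner_fun_raise_parameter_shift [of b k a x]
    unfolding Q_def R_def T_def by simp_all
  show ?thesis
  proof (cases n)
    case 0
    show ?thesis
      unfolding 0 by (simp add: algebra_simps)
  next
    case (Suc m)
    define M :: 'a where "M = of_nat (Suc m)"
    have N: "N = M + 1" "of_nat n = M"
      by (simp_all add: N_def M_def Suc)
    have "Q (Suc (Suc n)) - N * (1 + b) * Q (Suc n) + b * N * M * Q n =
        (a + b * x) * ((R (Suc n) - b * N * R n) - N * (R n - b * M * R m))
        - x * ((T (Suc n) - N * T n) - b * N * (T n - M * T m))"
      unfolding Q by (simp add: Suc Q algebra_simps)
    also have "\<dots> = (a + b * x) * (Q (Suc n) - N * Q n) - x * (Q (Suc n) - b * N * Q n)"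
      using QR [of n] QR [of m] QT [of n] QT [of m] by (simp add: Suc N_def M_def)
    finally have "Q (Suc (Suc n)) = (N * (1 + b) + a - (1 - b) * x) * Q (Suc n)
        - N * (a + b * M) * Q n"
      by (simp add: algebra_simps)
    then show ?thesis
      unfolding Q_def N_def [symmetric] N(2) .
  qed
qed

text \<open>
  The two terms of the raising recursion add one factor to \<open>step_pochhammer\<close> and one factor to
  \<open>pochhammer (- x)\<close>, respectively, so the coefficients obey Pascal's rule.
\<close>

lemma meixner_fun_explicit:
  fixes b a x :: "'a::comm_ring_1"
  shows "meixner_fun b n a x =
    (\<Sum>i\<le>n. of_nat (n choose i) * pochhammer (- x) (n - i) * step_pochhammer b (a + b * x) i)"
proof (induction n arbitrary: a x)
  case 0
  show ?case by simp
next
  case (Suc n)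
  define f where "f m i = pochhammer (- x) (m - i) * step_pochhammer b (a + b * x) i" for m i
  have up: "(a + b * x) * meixner_fun b n (a + b) x = (\<Sum>i\<le>n. of_nat (n choose i) * f (Suc n) (Suc i))"
    unfolding Suc.IH sum_distrib_left f_def
    by (intro sum.cong) (simp_all add: step_pochhammer_rec algebra_simps)
  have down: "- x * meixner_fun b n (a + b) (x - 1) = (\<Sum>i\<le>n. of_nat (n choose i) * f (Suc n) i)"
    unfolding Suc.IH sum_distrib_left f_def
    by (intro sum.cong) (simp_all add: pochhammer_rec Suc_diff_le algebra_simps)
  have "meixner_fun b (Suc n) a x =
      (a + b * x) * meixner_fun b n (a + b) x + (- x * meixner_fun b n (a + b) (x - 1))"
    by simp
  also have "\<dots> = (\<Sum>i\<le>n. of_nat (n choose i) * f (Suc n) (Suc i)) +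
      (\<Sum>i\<le>n. of_nat (n choose i) * f (Suc n) i)"
    unfolding up down ..
  also have "(\<Sum>i\<le>n. of_nat (n choose i) * f (Suc n) i) =
      f (Suc n) 0 + (\<Sum>i\<le>n. of_nat (n choose (Suc i)) * f (Suc n) (Suc i))"
    using sum.atMost_Suc_shift [of "\<lambda>i. of_nat (n choose i) * f (Suc n) i" n]
    by (simp add: binomial_eq_0)
  also have "(\<Sum>i\<le>n. of_nat (n choose i) * f (Suc n) (Suc i)) +
      (f (Suc n) 0 + (\<Sum>i\<le>n. of_nat (n choose (Suc i)) * f (Suc n) (Suc i))) =
      (\<Sum>i\<le>Suc n. of_nat (Suc n choose i) * f (Suc n) i)"
    unfolding sum.atMost_Suc_shift by (simp add: sum.distrib algebra_simps)
  finally show ?case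
    unfolding f_def by (simp add: mult.assoc)
qed

lemma meixner_fun_at_0: "meixner_fun b n a 0 = step_pochhammer b a n"
  by (induction n arbitrary: a) (simp_all add: step_pochhammer_rec)

lemma meixner_fun_of_real:
  "meixner_fun (of_real b) n (of_real a) (of_real x) = complex_of_real (meixner_fun b n a x)"
proof (induction n arbitrary: a x)
  case (Suc n)
  have "complex_of_real a + of_real b = of_real (a + b)" "complex_of_real x - 1 = of_real (x - 1)"
    by simp_all
  then show ?case
    by (simp del: of_real_add of_real_diff add: Suc.IH)
       (simp only: of_real_add of_real_diff of_real_mult)
qed simp

section \<open>The limit of the scaled Meixner functions\<close>

text \<open>
  Successive terms have the ratio \<open>(c + b i) / (i + 1)\<close>, which tends to \<open>b < 1\<close>.
\<close>

lemma summable_step_pochhammer: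
  assumes "0 \<le> b" "b < 1" "0 \<le> (c::real)"
  shows "summable (\<lambda>i. step_pochhammer b c i / fact i)"
proof -
  \<comment> \<open>any ratio strictly between \<open>b\<close> and \<open>1\<close>\<close>
  define r where "r = (1 + b) / 2"
  define N where "N = nat \<lceil>c / (r - b)\<rceil>"
  have r: "b < r" "r < 1"
    using assms by (auto simp: r_def)
  have ratio: "c + b * real n \<le> r * real (Suc n)" if "n \<ge> N" for n
  proof -
    have "c / (r - b) \<le> real n"
      using that unfolding N_def by linarith
    then have "c \<le> (r - b) * real n"
      using r by (simp add: field_simps)
    then show ?thesis
      using r assms by (simp add: algebra_simps)
  qed
  show ?thesis
  proof (rule summable_ratio_test)
    show "r < 1" by (rule r)
    fix n
    assume n: "n \<ge> N"
    have "norm (step_pochhammer b c (Suc n) / fact (Suc n)) =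
        (c + b * real n) / real (Suc n) * norm (step_pochhammer b c n / fact n)"
      using assms by (simp add: step_pochhammer_Suc abs_mult abs_divide mult.commute)
    also have "\<dots> \<le> r * norm (step_pochhammer b c n / fact n)"
      using ratio [OF n] by (intro mult_right_mono) (auto simp: field_simps)
    finally show "norm (step_pochhammer b c (Suc n) / fact (Suc n)) \<le>
        r * norm (step_pochhammer b c n / fact n)" .
  qed
qed

lemma norm_step_pochhammer_le:
  assumes "0 \<le> b" "norm w \<le> c"
  shows "norm (step_pochhammer (complex_of_real b) w i) \<le> step_pochhammer b c i"
  unfolding step_pochhammer_def prod_norm [symmetric]
proof (intro prod_mono conjI norm_ge_zero)
  fix j
  have "norm (w + complex_of_real b * of_nat j) \<le> norm w + norm (complex_of_real b * of_nat j)"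
    by (rule norm_triangle_ineq)
  then show "norm (w + complex_of_real b * of_nat j) \<le> c + b * real j"
    using assms by (simp add: norm_mult)
qed

text \<open>
  The factor of \<open>1 / \<Gamma>(- z)\<close> in the limit: the power of \<open>1 - b\<close> with exponent \<open>- z - a / b\<close>, and its
  limit \<open>exp a\<close> as \<open>b\<close> tends to \<open>0\<close>.
\<close>

definition limit_factor :: "real \<Rightarrow> real \<Rightarrow> complex \<Rightarrow> complex"
  where "limit_factor b a z =
    (if b = 0 then exp (of_real a) else exp (- (of_real (a / b) + z) * of_real (ln (1 - b))))"

text \<open>
  For \<open>b \<noteq> 0\<close> this is Newton's binomial series for the exponent \<open>- z - a / b\<close> at \<open>- b\<close>.
\<close>

lemma limit_factor_sums:
  assumes "0 \<le> b" "b < 1"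
  shows "(\<lambda>i. step_pochhammer (of_real b) (of_real a + of_real b * z) i / fact i) sums limit_factor b a z"
proof (cases "b = 0")
  case True
  then show ?thesis
    using exp_converges [of "complex_of_real a"]
    by (simp add: limit_factor_def step_pochhammer_def scaleR_conv_of_real field_simps)
next
  case False
  define w where "w = complex_of_real (a / b) + z"
  have "step_pochhammer (of_real b) (of_real a + of_real b * z) i = pochhammer w i * of_real b ^ i" for i
  proof -
    have "of_real a + of_real b * z + of_real b * of_nat j = (w + of_nat j) * of_real b" for j
      using False by (simp add: w_def field_simps)
    then show ?thesis
      unfolding pochhammer_prod step_pochhammer_def atLeast0LessThan by (simp add: prod.distrib)
  qed
  then have "((- w) gchoose i) * (- of_real b) ^ i =
      step_pochhammer (of_real b) (of_real a + of_real b * z) i / fact i" for i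
    by (simp add: gbinomial_pochhammer field_simps flip: power_mult_distrib)
  moreover have "(\<lambda>i. ((- w) gchoose i) * (- of_real b) ^ i) sums (1 + (- of_real b)) powr (- w)"
    by (rule gen_binomial_complex) (use assms in auto)
  moreover have "(1 + (- complex_of_real b)) powr (- w) = limit_factor b a z"
    using assms False by (simp add: powr_def limit_factor_def w_def flip: Ln_of_real)
  ultimately show ?thesis
    by simp
qed

lemma limit_factor_translate: "limit_factor b (a + b) (z - 1) = limit_factor b a z"
  by (auto simp: limit_factor_def add_divide_distrib)

lemma limit_factor_raise:
  assumes "b < 1"
  shows "of_real (1 - b) * limit_factor b (a + b) z = limit_factor b a z"
proof (cases "b = 0")
  case False
  have "complex_of_real (1 - b) = exp (of_real (ln (1 - b)))"
    using assms by (subst exp_of_real) simp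
  then show ?thesis
    using False by (simp only: exp_add [symmetric] limit_factor_def if_False)
      (simp add: add_divide_distrib algebra_simps)
qed (simp add: limit_factor_def)

lemma continuous_on_limit_factor [continuous_intros]: "continuous_on S (limit_factor b a)"
  unfolding limit_factor_def by (cases "b = 0") (auto intro!: continuous_intros)

lemma continuous_on_limit: "continuous_on S (\<lambda>z. limit_factor b a z * rGamma (- z))"
  by (intro continuous_intros continuous_on_rGamma_compose)

definition scaled_meixner :: "real \<Rightarrow> real \<Rightarrow> nat \<Rightarrow> complex \<Rightarrow> complex"
  where "scaled_meixner b a n z = rGamma (of_nat n - z) * meixner_fun (of_real b) n (of_real a) z"

text \<open>
  The quotient \<open>n! \<Gamma>(n - i - z) / ((n - i)! \<Gamma>(n - z))\<close>, by which the \<open>i\<close>-th term of the expansion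
  of the scaled function differs from the \<open>i\<close>-th term of the limiting series.
\<close>

definition tannery_factor :: "nat \<Rightarrow> nat \<Rightarrow> complex \<Rightarrow> complex"
  where "tannery_factor n i z = (\<Prod>j<i. of_nat (n - i + j + 1) / (of_nat (n - i + j) - z))"

text \<open>
  Since \<open>1 / \<Gamma>(- z) = (- z)\<^sub>n / \<Gamma>(n - z)\<close>, the factor \<open>(- z)\<^sub>n\<^sub>-\<^sub>i / \<Gamma>(n - z)\<close> of the \<open>i\<close>-th term of the
  explicit formula is \<open>1 / \<Gamma>(- z)\<close> divided by the last \<open>i\<close> factors of \<open>(- z)\<^sub>n\<close>; these do not vanish
  when \<open>Re z < 0\<close>.
\<close>

lemma scaled_meixner_expansion:
  assumes "Re z < 0"
  shows "scaled_meixner b a n z = rGamma (- z) *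
    (\<Sum>i\<le>n. tannery_factor n i z *
      (step_pochhammer (of_real b) (of_real a + of_real b * z) i / fact i))"
proof -
  have coeff: "of_nat (n choose i) * pochhammer (- z) (n - i) * rGamma (of_nat n - z) =
      rGamma (- z) * tannery_factor n i z / fact i" if "i \<le> n" for i
  proof -
    define d where "d = pochhammer (- z + of_nat (n - i)) i"
    have d: "d = (\<Prod>j<i. of_nat (n - i + j) - z)"
      unfolding d_def pochhammer_prod atLeast0LessThan by (simp add: algebra_simps)
    have "d \<noteq> 0"
    proof -
      have "of_nat m - z \<noteq> 0" for m
        using assms by (auto dest: arg_cong [where f = Re])
      then show ?thesis
        unfolding d prod_zero_iff [OF finite_lessThan] by blast
    qed
    have fact_n: "fact n = fact (n - i) * (\<Prod>j<i. of_nat (n - i + j + 1) :: complex)"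
      using pochhammer_product [of "n - i" n "1 :: complex"] that
      by (simp add: pochhammer_fact [symmetric] pochhammer_prod [of _ i] atLeast0LessThan algebra_simps)
    have "rGamma (- z) = pochhammer (- z) (n - i) * d * rGamma (of_nat n - z)"
      using pochhammer_rGamma [of "- z" n] pochhammer_product [of "n - i" n "- z"] that
      by (simp add: d_def)
    moreover have "tannery_factor n i z = fact n / fact (n - i) / d"
      using fact_n unfolding tannery_factor_def prod_dividef d by simp
    moreover have "of_nat (n choose i) = (fact n / fact (n - i) / fact i :: complex)"
      using that by (simp add: binomial_fact)
    ultimately show ?thesis
      using \<open>d \<noteq> 0\<close> by simp
  qed
  show ?thesis
    unfolding scaled_meixner_def meixner_fun_explicit sum_distrib_left
  proof (rule sum.cong)
    fix i
    assume "i \<in> {..n}"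
    then show "rGamma (of_nat n - z) * (of_nat (n choose i) * pochhammer (- z) (n - i) *
        step_pochhammer (of_real b) (of_real a + of_real b * z) i) =
      rGamma (- z) * (tannery_factor n i z *
        (step_pochhammer (of_real b) (of_real a + of_real b * z) i / fact i))"
      using coeff [of i] by (simp add: field_simps)
  qed simp
qed

lemma norm_of_nat_minus_ge:
  assumes "Re z \<le> - 1"
  shows "real m + 1 \<le> norm (of_nat m - z)"
  using complex_Re_le_cmod [of "of_nat m - z"] assms by simp

lemma norm_tannery_factor_le:
  assumes "Re z \<le> - 1"
  shows "norm (tannery_factor n i z) \<le> 1"
proof -
  have "norm (of_nat (m + 1) / (of_nat m - z)) \<le> 1" for m
    using norm_of_nat_minus_ge [OF assms, of m] by (simp add: norm_divide divide_le_eq_1 del: of_nat_Suc of_nat_add)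
  then show ?thesis
    unfolding tannery_factor_def prod_norm [symmetric]
    by (intro prod_le_1 conjI norm_ge_zero) blast
qed

text \<open>
  All factors of the product lie in the unit disc, so the distance of the product from \<open>1\<close> is at most
  the sum of the distances of the factors from \<open>1\<close>.
\<close>

lemma norm_tannery_factor_minus_1_le:
  assumes "Re z \<le> - 1" "norm z \<le> R"
  shows "norm (tannery_factor n i z - 1) \<le> real i * ((1 + R) / real (n - i + 1))"
proof -
  define q where "q m = of_nat (m + 1) / (of_nat m - z)" for m
  have q_le: "norm (q m) \<le> 1" and q_diff: "norm (q m - 1) \<le> (1 + R) / real (m + 1)" for m
  proof -
    have m: "real m + 1 \<le> norm (of_nat m - z)"
      using assms(1) by (rule norm_of_nat_minus_ge)
    have "norm (1 + z) \<le> 1 + R" "0 \<le> 1 + R"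
      using norm_triangle_ineq [of 1 z] assms(2) norm_ge_zero [of z]
      unfolding norm_one by linarith+
    from m show "norm (q m) \<le> 1"
      by (simp add: q_def norm_divide divide_le_eq_1 del: of_nat_Suc of_nat_add)
    have "of_nat m - z \<noteq> 0"
      using m by force
    then have "q m - 1 = (1 + z) / (of_nat m - z)"
      by (simp add: q_def field_simps)
    also have "norm \<dots> \<le> (1 + R) / real (m + 1)"
      unfolding norm_divide using m \<open>norm (1 + z) \<le> 1 + R\<close> \<open>0 \<le> 1 + R\<close>
      by (intro frac_le) simp_all
    finally show "norm (q m - 1) \<le> (1 + R) / real (m + 1)" .
  qed
  have "norm ((\<Prod>j<i. q (n - i + j)) - (\<Prod>j<i. 1)) \<le> (\<Sum>j<i. norm (q (n - i + j) - 1))"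
    by (rule norm_prod_diff) (use q_le in auto)
  also have "\<dots> \<le> (\<Sum>j<i. (1 + R) / real (n - i + 1))"
  proof (rule sum_mono)
    fix j
    have "norm (q (n - i + j) - 1) \<le> (1 + R) / real (n - i + j + 1)"
      by (rule q_diff)
    also have "\<dots> \<le> (1 + R) / real (n - i + 1)"
      using order_trans [OF norm_ge_zero assms(2)] by (intro divide_left_mono) auto
    finally show "norm (q (n - i + j) - 1) \<le> (1 + R) / real (n - i + 1)" .
  qed
  finally show ?thesis
    by (simp add: tannery_factor_def q_def)
qed

text \<open>
  In this half-plane \<open>tannery_factor\<close> is bounded by \<open>1\<close>, and the remaining factor of each term is
  dominated by a summable sequence that depends only on a bound for \<open>\<bar>z\<bar>\<close>.
\<close>

lemma uniform_limit_scaled_meixner_left: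
  assumes b: "0 \<le> b" "b < 1" and "0 \<le> a" and K: "compact K" "\<And>z. z \<in> K \<Longrightarrow> Re z \<le> - 1"
  shows "uniform_limit K (scaled_meixner b a) (\<lambda>z. limit_factor b a z * rGamma (- z)) sequentially"
proof -
  obtain R where "R > 0" and R: "\<And>z. z \<in> K \<Longrightarrow> norm z \<le> R"
    using compact_imp_bounded [OF K(1)] bounded_pos by blast
  define u where
    "u i z = step_pochhammer (of_real b) (of_real a + of_real b * z) i / fact i" for i and z :: complex
  define M where "M i = step_pochhammer b (a + b * R) i / fact i" for i
  define f where "f i n z = (if i \<le> n then tannery_factor n i z * u i z else 0)" for i n z
  have M: "summable M"
    unfolding M_def using b \<open>0 \<le> a\<close> \<open>R > 0\<close> by (intro summable_step_pochhammer) auto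
  have u_le: "norm (u i z) \<le> M i" if "z \<in> K" for i z
  proof -
    have "norm (complex_of_real a + of_real b * z) \<le> norm (complex_of_real a) + norm (of_real b * z)"
      by (rule norm_triangle_ineq)
    also have "\<dots> \<le> a + b * R"
      using b \<open>0 \<le> a\<close> R [OF that] by (auto simp: norm_mult intro: mult_left_mono)
    finally show ?thesis
      unfolding u_def M_def norm_divide norm_fact using b
      by (intro divide_right_mono norm_step_pochhammer_le) auto
  qed
  have M_nonneg: "0 \<le> M i" for i
    unfolding M_def step_pochhammer_def using b \<open>0 \<le> a\<close> \<open>R > 0\<close>
    by (intro divide_nonneg_nonneg prod_nonneg) auto
  have "uniform_limit K (\<lambda>n z. \<Sum>i. f i n z) (\<lambda>z. \<Sum>i. u i z) sequentially"
  proof (rule uniform_limit_suminf_dominated [OF _ _ M])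
    fix i
    show "uniform_limit K (f i) (u i) sequentially"
    proof (rule uniform_limit_norm_diff_le)
      show "\<forall>\<^sub>F n in sequentially. \<forall>z\<in>K. norm (f i n z - u i z) \<le>
          real i * ((1 + R) / real (n - i + 1)) * M i"
        using eventually_ge_at_top [of i]
      proof eventually_elim
        case (elim n)
        show ?case
        proof
          fix z
          assume z: "z \<in> K"
          have "f i n z - u i z = (tannery_factor n i z - 1) * u i z"
            using elim by (simp add: f_def algebra_simps)
          then have "norm (f i n z - u i z) = norm (tannery_factor n i z - 1) * norm (u i z)"
            by (simp add: norm_mult)
          also have "\<dots> \<le> real i * ((1 + R) / real (n - i + 1)) * M i"
            using z K R u_le \<open>R > 0\<close> by (intro mult_mono norm_tannery_factor_minus_1_le) auto
          finally show "norm (f i n z - u i z) \<le> real i * ((1 + R) / real (n - i + 1)) * M i" .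
        qed
      qed
      have "(\<lambda>n. real i * ((1 + R) / real (n + 1)) * M i) \<longlonglongrightarrow> 0"
        by real_asymp
      then have "(\<lambda>n. real i * ((1 + R) / real (n + i - i + 1)) * M i) \<longlonglongrightarrow> 0"
        by simp
      then show "(\<lambda>n. real i * ((1 + R) / real (n - i + 1)) * M i) \<longlonglongrightarrow> 0"
        by (rule LIMSEQ_offset)
    qed
  next
    fix i n z
    assume z: "z \<in> K"
    show "norm (f i n z) \<le> M i"
    proof (cases "i \<le> n")
      case True
      then have "norm (f i n z) = norm (tannery_factor n i z) * norm (u i z)"
        by (simp add: f_def norm_mult)
      also have "\<dots> \<le> 1 * M i"
        using z K u_le by (intro mult_mono norm_tannery_factor_le) auto
      finally show ?thesis by simp
    qed (use M_nonneg in \<open>simp add: f_def\<close>)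
  qed
  moreover have "(\<Sum>i. f i n z) = (\<Sum>i\<le>n. tannery_factor n i z * u i z)" for n z
    by (subst suminf_finite [of "{..n}"]) (auto simp: f_def)
  moreover have "(\<Sum>i. u i z) = limit_factor b a z" for z
    unfolding u_def using limit_factor_sums [OF b] by (rule sums_unique [symmetric])
  ultimately have lim: "uniform_limit K (\<lambda>n z. \<Sum>i\<le>n. tannery_factor n i z * u i z)
      (limit_factor b a) sequentially"
    by simp
  have "uniform_limit K (\<lambda>n z. rGamma (- z) * (\<Sum>i\<le>n. tannery_factor n i z * u i z))
      (\<lambda>z. rGamma (- z) * limit_factor b a z) sequentially"
    by (rule uniform_limit_mult_compact [OF K(1) _ _ _ lim])
      (auto intro!: continuous_intros continuous_on_rGamma_compose uniform_limit_const)
  moreover have "scaled_meixner b a n z = rGamma (- z) * (\<Sum>i\<le>n. tannery_factor n i z * u i z)"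
    if "z \<in> K" for n z
    unfolding u_def by (rule scaled_meixner_expansion) (use K(2) [OF that] in simp)
  ultimately show ?thesis
    by (subst uniform_limit_cong') (auto simp: mult.commute)
qed

text \<open>
  The raising recursion involves values at \<open>z\<close> and at \<open>z - 1\<close>. The lowering relation replaces the
  value at \<open>z\<close> by values at \<open>z - 1\<close>, and \<open>\<Gamma>(n + 2 - z) = (n + 1 - z) \<Gamma>(n + 1 - z)\<close> adjusts the
  scaling of the term whose degree has dropped. All coefficients on the right converge as \<open>n\<close> grows.
\<close>

lemma scaled_meixner_step:
  assumes "of_nat (Suc n) \<noteq> z"
  shows "scaled_meixner b a (Suc (Suc n)) z =
    (of_real a + of_real b * z - z) * scaled_meixner b (a + b) (Suc n) (z - 1)
    - of_real (1 - b) * (of_real a + of_real b * z) *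
      (of_nat (Suc n) / (of_nat (Suc n) - z) * scaled_meixner b (a + b + b) n (z - 1))"
proof -
  define c where "c = of_real a + of_real b * z"
  define g where "g = rGamma (of_nat (Suc (Suc n)) - z)"
  define N :: complex where "N = of_nat (Suc n)"
  define Q where "Q = meixner_fun (of_real b) (Suc n) (of_real a + of_real b) (z - 1)"
  define P where "P = meixner_fun (of_real b) n (of_real a + of_real b + of_real b) (z - 1)"
  have g: "rGamma (N - z) = (N - z) * g"
    using rGamma_plus1 [of "N - z"] by (simp add: g_def N_def algebra_simps)
  have "meixner_fun (of_real b) (Suc n) (of_real a + of_real b) z = Q - of_real (1 - b) * N * P"
    using meixner_fun_difference [of "of_real b" n "of_real a + of_real b" "z - 1"]
    by (simp add: Q_def P_def N_def algebra_simps del: meixner_fun.simps)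
  then have "scaled_meixner b a (Suc (Suc n)) z = g * (c * (Q - of_real (1 - b) * N * P) - z * Q)"
    unfolding scaled_meixner_def meixner_fun.simps(2) [of _ "Suc n"] g_def c_def
    by (simp only: Q_def)
  also have "\<dots> = (c - z) * (g * Q) - of_real (1 - b) * c * (N * (g * P))"
    by (simp add: algebra_simps)
  also have "g * P = rGamma (N - z) * P / (N - z)"
    using assms unfolding g by (simp add: N_def)
  also have "rGamma (N - z) * P = scaled_meixner b (a + b + b) n (z - 1)"
    by (simp add: scaled_meixner_def P_def N_def algebra_simps)
  also have "g * Q = scaled_meixner b (a + b) (Suc n) (z - 1)"
    by (simp add: scaled_meixner_def Q_def g_def algebra_simps del: meixner_fun.simps)
  finally show ?thesis
    by (simp add: c_def N_def)
qed

text \<open>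
  Induction over strips of width \<open>1\<close>. The parameter \<open>a\<close> must be arbitrary, because each step to the
  right uses the limits for \<open>a + b\<close> and \<open>a + 2 b\<close>.
\<close>

lemma uniform_limit_scaled_meixner_half_plane:
  assumes b: "0 \<le> b" "b < 1"
  shows "0 \<le> a \<Longrightarrow> compact K \<Longrightarrow> (\<And>z. z \<in> K \<Longrightarrow> Re z \<le> real m - 1) \<Longrightarrow>
    uniform_limit K (scaled_meixner b a) (\<lambda>z. limit_factor b a z * rGamma (- z)) sequentially"
proof (induction m arbitrary: a K)
  case 0
  then show ?case
    using b by (intro uniform_limit_scaled_meixner_left) auto
next
  case (Suc m)
  note K = \<open>compact K\<close>
  have shifted: "uniform_limit K (\<lambda>n z. scaled_meixner b a' n (z - 1))
      (\<lambda>z. limit_factor b a' (z - 1) * rGamma (- (z - 1))) sequentially" if "0 \<le> a'" for a'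
  proof (rule uniform_limit_compose')
    show "uniform_limit ((\<lambda>z. z - 1) ` K) (scaled_meixner b a')
        (\<lambda>z. limit_factor b a' z * rGamma (- z)) sequentially"
    proof (rule Suc.IH [OF that])
      show "compact ((\<lambda>z. z - 1) ` K)"
        using K by (intro compact_continuous_image continuous_intros)
      show "\<And>z. z \<in> (\<lambda>z. z - 1) ` K \<Longrightarrow> Re z \<le> real m - 1"
        using Suc.prems(3) by force
    qed
  qed auto
  have cont: "continuous_on K (\<lambda>z. limit_factor b a' (z - 1) * rGamma (- (z - 1)))" for a'
    by (intro continuous_intros continuous_on_rGamma_compose
        continuous_on_compose2 [OF continuous_on_limit_factor]) auto
  have nonneg: "0 \<le> a + b" "0 \<le> a + b + b"
    using b Suc.prems by auto
  let ?c = "\<lambda>z. of_real a + of_real b * z"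
  have c: "continuous_on K ?c" "continuous_on K (\<lambda>z. ?c z - z)"
    "continuous_on K (\<lambda>z. of_real (1 - b) * ?c z)" "continuous_on K (\<lambda>z. 1 :: complex)"
    by (intro continuous_intros)+
  have ratio: "uniform_limit K (\<lambda>n z. of_nat (Suc n) / (of_nat (Suc n) - z)) (\<lambda>z. 1) sequentially"
    using uniform_limit_ratio_shift [OF K]
    by (subst filterlim_sequentially_Suc [of "\<lambda>n z. of_nat n / (of_nat n - z)"])
  have shifted_Suc: "uniform_limit K (\<lambda>n z. scaled_meixner b (a + b) (Suc n) (z - 1))
      (\<lambda>z. limit_factor b (a + b) (z - 1) * rGamma (- (z - 1))) sequentially"
    using shifted [OF nonneg(1)]
    by (subst filterlim_sequentially_Suc [of "\<lambda>n z. scaled_meixner b (a + b) n (z - 1)"])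
  have "uniform_limit K (\<lambda>n z.
      (?c z - z) * scaled_meixner b (a + b) (Suc n) (z - 1)
      - of_real (1 - b) * ?c z *
        (of_nat (Suc n) / (of_nat (Suc n) - z) * scaled_meixner b (a + b + b) n (z - 1)))
    (\<lambda>z. (?c z - z) * (limit_factor b (a + b) (z - 1) * rGamma (- (z - 1)))
      - of_real (1 - b) * ?c z * (1 * (limit_factor b (a + b + b) (z - 1) * rGamma (- (z - 1)))))
    sequentially"
    by (intro uniform_limit_minus uniform_limit_mult_compact uniform_limit_const K c cont
        ratio shifted_Suc shifted nonneg continuous_on_mult)
  moreover have "\<forall>\<^sub>F n in sequentially. \<forall>z\<in>K.
      (?c z - z) * scaled_meixner b (a + b) (Suc n) (z - 1)
      - of_real (1 - b) * ?c z *
        (of_nat (Suc n) / (of_nat (Suc n) - z) * scaled_meixner b (a + b + b) n (z - 1)) =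
      scaled_meixner b a (Suc (Suc n)) z"
    using eventually_of_nat_avoids_compact [OF K]
    unfolding eventually_sequentially_Suc [of "\<lambda>n. \<forall>z\<in>K. of_nat n \<noteq> z", symmetric]
  proof eventually_elim
    case (elim n)
    show ?case
      using elim by (intro ballI scaled_meixner_step [symmetric]) blast
  qed
  moreover have "(?c z - z) * (limit_factor b (a + b) (z - 1) * rGamma (- (z - 1)))
      - of_real (1 - b) * ?c z * (1 * (limit_factor b (a + b + b) (z - 1) * rGamma (- (z - 1)))) =
      limit_factor b a z * rGamma (- z)" for z
  proof -
    have "of_real (1 - b) * limit_factor b (a + b + b) (z - 1) = limit_factor b a z"
      using limit_factor_raise [OF b(2), of "a + b" "z - 1"] limit_factor_translate [of b a z] by simp
    moreover have "rGamma (- z) = - z * rGamma (- (z - 1))"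
      using rGamma_plus1 [of "- z"] by (simp add: algebra_simps)
    moreover have "(?c z - z) * (limit_factor b a z * rGamma (- (z - 1)))
      - of_real (1 - b) * ?c z * (1 * (limit_factor b (a + b + b) (z - 1) * rGamma (- (z - 1)))) =
      ((?c z - z) * limit_factor b a z - ?c z * (of_real (1 - b) * limit_factor b (a + b + b) (z - 1)))
        * rGamma (- (z - 1))"
      by (simp add: algebra_simps)
    ultimately show ?thesis
      unfolding limit_factor_translate [of b a z] by (simp only:) (simp add: algebra_simps)
  qed
  ultimately have "uniform_limit K (\<lambda>n. scaled_meixner b a (Suc (Suc n)))
      (\<lambda>z. limit_factor b a z * rGamma (- z)) sequentially"
    by (rule uniform_limit_transform_eventually)
  then show ?case
    by (simp only: filterlim_sequentially_Suc [of "\<lambda>n. scaled_meixner b a (Suc n)"]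
        filterlim_sequentially_Suc [of "scaled_meixner b a"])
qed

lemma scaled_meixner_limit:
  assumes "0 \<le> b" "b < 1" "0 \<le> a"
  shows "locally_uniform_limit (scaled_meixner b a) (\<lambda>z. limit_factor b a z * rGamma (- z))"
  unfolding locally_uniform_limit_def
proof (intro allI impI)
  fix K :: "complex set"
  assume K: "compact K"
  obtain R where R: "\<And>z. z \<in> K \<Longrightarrow> norm z \<le> R"
    using compact_imp_bounded [OF K] unfolding bounded_iff by blast
  obtain m :: nat where m: "R + 1 \<le> real m"
    using real_arch_simple by blast
  show "uniform_limit K (scaled_meixner b a) (\<lambda>z. limit_factor b a z * rGamma (- z)) sequentially"
  proof (rule uniform_limit_scaled_meixner_half_plane [OF assms K])
    show "Re z \<le> real m - 1" if "z \<in> K" for z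
      using R [OF that] complex_Re_le_cmod [of z] m by linarith
  qed
qed

section \<open>Monic Meixner polynomials\<close>

definition meixner_poly :: "real \<Rightarrow> real \<Rightarrow> nat \<Rightarrow> real poly"
  where "meixner_poly b a = monic_recurrence
    (\<lambda>n. (real n * (1 + b) + a) / (1 - b))
    (\<lambda>n. real n * (a + b * (real n - 1)) / (1 - b)\<^sup>2)"

lemma charlier_eq_meixner_poly: "charlier \<mu> = meixner_poly 0 \<mu>"
  by (simp add: charlier_def meixner_poly_def)

lemma meixner_eq_meixner_poly: "meixner \<gamma> \<mu> = meixner_poly \<mu> (\<mu> * \<gamma>)"
  unfolding meixner_def meixner_poly_def
  by (simp add: power2_commute [of \<mu> 1] algebra_simps)

lemma degree_lead_coeff_monic_recurrence:
  "degree (monic_recurrence \<alpha> \<beta> n) = n \<and> lead_coeff (monic_recurrence \<alpha> \<beta> n) = 1"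
proof (induction n rule: induct_nat_012)
  case (ge2 n)
  let ?P = "monic_recurrence \<alpha> \<beta>"
  let ?p = "[:- \<alpha> (Suc n), 1:] * ?P (Suc n)" and ?q = "smult (\<beta> (Suc n)) (?P n)"
  have "?P (Suc n) \<noteq> 0"
    using ge2.IH(2) by auto
  then have p: "degree ?p = Suc (Suc n)" "coeff ?p (Suc (Suc n)) = 1"
    using conjunct1 [OF ge2.IH(2)] conjunct2 [OF ge2.IH(2)]
      lead_coeff_mult [of "[:- \<alpha> (Suc n), 1:]" "?P (Suc n)"]
    by (simp_all add: degree_mult_eq del: mult_pCons_left)
  have q: "degree ?q < Suc (Suc n)"
    using ge2.IH(1) degree_smult_le [of "\<beta> (Suc n)" "?P n"] by linarith
  have "degree (?p - ?q) = Suc (Suc n)"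
    using p q degree_add_eq_left [of "- ?q" ?p] by (simp del: mult_pCons_left)
  then show ?case
    using p coeff_eq_0 [OF q] by (simp del: mult_pCons_left)
qed auto

lemma degree_meixner_poly [simp]: "degree (meixner_poly b a n) = n"
  unfolding meixner_poly_def by (rule conjunct1 [OF degree_lead_coeff_monic_recurrence])

lemma coeff_meixner_poly [simp]: "coeff (meixner_poly b a n) n = 1"
proof -
  have "lead_coeff (meixner_poly b a n) = 1"
    unfolding meixner_poly_def by (rule conjunct2 [OF degree_lead_coeff_monic_recurrence])
  then show ?thesis by simp
qed

lemma meixner_poly_nonzero [simp]: "meixner_poly b a n \<noteq> 0"
proof
  assume "meixner_poly b a n = 0"
  then show False
    using coeff_meixner_poly [of b a n] by simp
qed

lemma meixner_poly_three_term:
  "meixner_poly b a (Suc (Suc n)) =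
     [:- ((real (Suc n) * (1 + b) + a) / (1 - b)), 1:] * meixner_poly b a (Suc n)
     - smult (real (Suc n) * (a + b * real n) / (1 - b)\<^sup>2) (meixner_poly b a n)"
  by (simp add: meixner_poly_def)

lemma cpoly_add: "cpoly (p + q) z = cpoly p z + cpoly q z"
  by (subst poly_add [symmetric], rule arg_cong [where f = "\<lambda>p. poly p z"])
     (rule poly_eqI, simp add: coeff_map_poly)

lemma cpoly_smult: "cpoly (smult c p) z = of_real c * cpoly p z"
  by (simp add: map_poly_smult)

lemma cpoly_diff: "cpoly (p - q) z = cpoly p z - cpoly q z"
  using cpoly_add [of p "smult (- 1) q" z] cpoly_smult [of "- 1" q z] by simp

lemma cpoly_pCons: "cpoly (pCons c p) z = of_real c + z * cpoly p z"
  by (simp add: map_poly_pCons)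

lemma cpoly_linear_mult: "cpoly ([:c, d:] * p) z = (of_real c + of_real d * z) * cpoly p z"
  by (simp add: cpoly_add cpoly_smult cpoly_pCons algebra_simps)

lemma cpoly_translate: "cpoly (pcompose p [:c, 1:]) z = cpoly p (z + of_real c)"
proof (induction p)
  case (pCons d p)
  have "cpoly (pcompose (pCons d p) [:c, 1:]) z = cpoly [:d:] z + cpoly ([:c, 1:] * pcompose p [:c, 1:]) z"
    unfolding pcompose_pCons by (rule cpoly_add)
  then show ?case
    unfolding cpoly_linear_mult pCons.IH cpoly_pCons by (simp add: algebra_simps)
qed simp

lemma cpoly_of_real: "cpoly p (of_real x) = of_real (poly p x)"
  by (induction p) (simp_all add: cpoly_pCons)

text \<open>
  Both sides satisfy the same three-term recurrence. With \<open>e = b - 1\<close> as the basic quantity, the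
  denominators of the coefficients are powers of \<open>e\<close> and cancel against \<open>e\<^sup>n\<close>.
\<close>

lemma cpoly_meixner_poly:
  assumes "b \<noteq> 1"
  shows "of_real (b - 1) ^ n * cpoly (meixner_poly b a n) z =
    meixner_fun (of_real b) n (of_real a) z"
proof -
  define e where "e = complex_of_real (b - 1)"
  have e: "e \<noteq> 0" and bE: "complex_of_real b = 1 + e"
    using assms by (auto simp: e_def)
  show ?thesis
  proof (induction n rule: induct_nat_012)
    case 1
    have "complex_of_real ((real 0 * (1 + b) + a) / (1 - b)) = - (of_real a / e)"
      using assms by (simp add: e_def field_simps)
    then show ?case
      using e by (simp add: meixner_poly_def cpoly_pCons bE e_def [symmetric] field_simps)
  next
    case (ge2 n)
    define N where "N = complex_of_nat (Suc n)"
    let ?P = "\<lambda>k. cpoly (meixner_poly b a k) z"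
    let ?Q = "\<lambda>k. meixner_fun (of_real b) k (of_real a) z"
    have P: "?P (Suc (Suc n)) = (z + (N * (2 + e) + of_real a) / e) * ?P (Suc n)
        - N * (of_real a + (1 + e) * of_nat n) / e\<^sup>2 * ?P n"
    proof -
      have 1: "complex_of_real (- ((real (Suc n) * (1 + b) + a) / (1 - b))) = (N * (2 + e) + of_real a) / e"
      proof -
        have "- ((real (Suc n) * (1 + b) + a) / (1 - b)) = (real (Suc n) * (2 + (b - 1)) + a) / (b - 1)"
          by (simp add: minus_divide_right)
        then show ?thesis
          by (simp only: N_def e_def of_real_divide of_real_add of_real_mult of_real_of_nat_eq of_real_numeral)
      qed
      have 2: "complex_of_real (real (Suc n) * (a + b * real n) / (1 - b)\<^sup>2) =
          N * (of_real a + (1 + e) * of_nat n) / e\<^sup>2"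
        unfolding power2_commute [of 1 b] by (simp add: N_def e_def)
      show ?thesis
        unfolding meixner_poly_three_term cpoly_diff cpoly_smult cpoly_linear_mult 1 2
        by (simp add: algebra_simps)
    qed
    have "e ^ Suc (Suc n) * ?P (Suc (Suc n)) =
        (e * z + (N * (2 + e) + of_real a)) * (e ^ Suc n * ?P (Suc n))
        - N * (of_real a + (1 + e) * of_nat n) * (e ^ n * ?P n)"
      unfolding P using e by (simp add: field_simps power2_eq_square)
    also have "\<dots> = (e * z + (N * (2 + e) + of_real a)) * ?Q (Suc n)
        - N * (of_real a + (1 + e) * of_nat n) * ?Q n"
      using ge2.IH unfolding e_def by simp
    also have "\<dots> = ?Q (Suc (Suc n))"
      unfolding meixner_fun_three_term N_def [symmetric] bE by (simp add: algebra_simps)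
    finally show ?case
      unfolding e_def .
  qed (simp add: meixner_poly_def)
qed

lemma poly_meixner_poly:
  assumes "b \<noteq> 1"
  shows "(b - 1) ^ n * poly (meixner_poly b a n) x = meixner_fun b n a x"
proof -
  have "complex_of_real ((b - 1) ^ n * poly (meixner_poly b a n) x) = of_real (meixner_fun b n a x)"
    using cpoly_meixner_poly [OF assms, of n a "of_real x"]
    unfolding cpoly_of_real meixner_fun_of_real by simp
  then show ?thesis
    by (simp only: of_real_eq_iff)
qed

text \<open>
  The polynomial form of the raising recursion. Divided by \<open>1 - b\<close>, the operator on the right is the
  adjoint of the forward difference with respect to the weights for \<open>a\<close> and \<open>a + b\<close>.
\<close>

lemma meixner_poly_raise:
  assumes "b \<noteq> 1"
  shows "smult (1 - b) (meixner_poly b a (Suc n)) =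
    [:0, 1:] * pcompose (meixner_poly b (a + b) n) [:- 1, 1:] - [:a, b:] * meixner_poly b (a + b) n"
proof (rule poly_eq_poly_eq_iff [THEN iffD1], rule ext)
  fix x
  define p where "p y = poly (meixner_poly b (a + b) n) y" for y
  have "(b - 1) ^ n * ((b - 1) * poly (meixner_poly b a (Suc n)) x) =
      (b - 1) ^ n * ((a + b * x) * p x - x * p (x - 1))"
    using poly_meixner_poly [OF assms, of "Suc n" a x] poly_meixner_poly [OF assms, of n "a + b"]
    by (simp add: p_def algebra_simps)
  then have "(b - 1) * poly (meixner_poly b a (Suc n)) x = (a + b * x) * p x - x * p (x - 1)"
    using assms by simp
  then show "poly (smult (1 - b) (meixner_poly b a (Suc n))) x =
      poly ([:0, 1:] * pcompose (meixner_poly b (a + b) n) [:- 1, 1:] - [:a, b:] * meixner_poly b (a + b) n) x"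
    by (simp add: p_def poly_pcompose algebra_simps)
qed

section \<open>Orthogonality\<close>

definition meixner_weight :: "real \<Rightarrow> real \<Rightarrow> nat \<Rightarrow> real"
  where "meixner_weight b a x = step_pochhammer b a x / fact x"

lemma meixner_weight_Suc: "real (Suc x) * meixner_weight b a (Suc x) = a * meixner_weight b (a + b) x"
  by (simp add: meixner_weight_def step_pochhammer_rec field_simps del: of_nat_Suc)

lemma meixner_weight_raise: "(a + b * real x) * meixner_weight b a x = a * meixner_weight b (a + b) x"
  using step_pochhammer_rec [of b a x] by (simp add: meixner_weight_def step_pochhammer_Suc field_simps)

lemma meixner_weight_pos: "0 \<le> b \<Longrightarrow> 0 < a \<Longrightarrow> 0 < meixner_weight b a x"
  unfolding meixner_weight_def step_pochhammer_def
  by (intro divide_pos_pos prod_pos) (auto intro: add_pos_nonneg)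

text \<open>
  A factor \<open>x\<close> can be absorbed into the weight by shifting the summation index and passing from \<open>a\<close>
  to \<open>a + b\<close>, which lowers the degree of the polynomial by one.
\<close>

lemma summable_poly_meixner_weight_aux:
  assumes b: "0 \<le> b" "b < 1"
  shows "0 \<le> a \<Longrightarrow> degree p \<le> n \<Longrightarrow> summable (\<lambda>x. poly p (real x) * meixner_weight b a x)"
proof (induction n arbitrary: p a)
  case 0
  then obtain c where "p = [:c:]"
    by (metis degree_eq_zeroE le_zero_eq)
  then show ?case
    using summable_mult [OF summable_step_pochhammer [OF b 0(1)], of c]
    by (simp add: meixner_weight_def)
next
  case (Suc n)
  obtain c q where p: "p = pCons c q"
    by (cases p)
  have "degree q \<le> n"
    using Suc.prems(2) unfolding p by (auto split: if_splits)
  then have "degree (pcompose q [:1, 1:]) \<le> n"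
    by (simp add: degree_pcompose)
  then have "summable (\<lambda>x. a * (poly (pcompose q [:1, 1:]) (real x) * meixner_weight b (a + b) x))"
    using b Suc.prems(1) by (intro summable_mult Suc.IH) auto
  also have "(\<lambda>x. a * (poly (pcompose q [:1, 1:]) (real x) * meixner_weight b (a + b) x)) =
      (\<lambda>x. real (Suc x) * poly q (real (Suc x)) * meixner_weight b a (Suc x))"
  proof
    fix x
    show "a * (poly (pcompose q [:1, 1:]) (real x) * meixner_weight b (a + b) x) =
        real (Suc x) * poly q (real (Suc x)) * meixner_weight b a (Suc x)"
      using arg_cong [OF meixner_weight_Suc [of x b a, symmetric], of "\<lambda>t. poly q (real (Suc x)) * t"]
      by (simp add: poly_pcompose mult_ac del: of_nat_Suc) (simp add: add.commute)
  qed
  finally have "summable (\<lambda>x. real x * poly q (real x) * meixner_weight b a x)"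
    by (subst summable_Suc_iff [symmetric])
  moreover have "summable (\<lambda>x. c * meixner_weight b a x)"
    unfolding meixner_weight_def
    using summable_step_pochhammer [OF b Suc.prems(1)] by (rule summable_mult)
  ultimately have "summable (\<lambda>x. c * meixner_weight b a x + real x * poly q (real x) * meixner_weight b a x)"
    by (intro summable_add)
  then show ?case
    by (simp add: p algebra_simps)
qed

lemma summable_poly_meixner_weight:
  assumes "0 \<le> b" "b < 1" "0 \<le> a"
  shows "summable (\<lambda>x. poly p (real x) * meixner_weight b a x)"
  using summable_poly_meixner_weight_aux [OF assms(1,2,3) order_refl] .

definition moment :: "real \<Rightarrow> real \<Rightarrow> real poly \<Rightarrow> real"
  where "moment b a p = (\<Sum>x. poly p (real x) * meixner_weight b a x)"

lemma moment_diff: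
  assumes "0 \<le> b" "b < 1" "0 \<le> a"
  shows "moment b a (p - q) = moment b a p - moment b a q"
  using suminf_diff [OF summable_poly_meixner_weight [OF assms, of p]
      summable_poly_meixner_weight [OF assms, of q]]
  by (simp add: moment_def algebra_simps)

lemma moment_add:
  assumes "0 \<le> b" "b < 1" "0 \<le> a"
  shows "moment b a (p + q) = moment b a p + moment b a q"
  using suminf_add [OF summable_poly_meixner_weight [OF assms, of p]
      summable_poly_meixner_weight [OF assms, of q]]
  by (simp add: moment_def algebra_simps)

lemma moment_smult:
  assumes "0 \<le> b" "b < 1" "0 \<le> a"
  shows "moment b a (smult c p) = c * moment b a p"
  using suminf_mult [OF summable_poly_meixner_weight [OF assms, of p], of c]
  by (simp add: moment_def mult.assoc)

lemma moment_0 [simp]: "moment b a 0 = 0"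
  by (simp add: moment_def)

lemma moment_shift:
  assumes "0 \<le> b" "b < 1" "0 \<le> a"
  shows "moment b a ([:0, 1:] * p) = a * moment b (a + b) (pcompose p [:1, 1:])"
proof -
  have "moment b a ([:0, 1:] * p) =
      (\<Sum>x. poly ([:0, 1:] * p) (real (Suc x)) * meixner_weight b a (Suc x))"
    using suminf_split_head [OF summable_poly_meixner_weight [OF assms, of "[:0, 1:] * p"]]
    by (simp add: moment_def)
  also have "\<dots> = (\<Sum>x. a * (poly (pcompose p [:1, 1:]) (real x) * meixner_weight b (a + b) x))"
  proof (intro suminf_cong)
    fix x
    show "poly ([:0, 1:] * p) (real (Suc x)) * meixner_weight b a (Suc x) =
        a * (poly (pcompose p [:1, 1:]) (real x) * meixner_weight b (a + b) x)"
      using arg_cong [OF meixner_weight_Suc [of x b a], of "\<lambda>t. poly p (real (Suc x)) * t"]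
      by (simp add: poly_pcompose mult_ac del: of_nat_Suc) (simp add: add.commute)
  qed
  also have "\<dots> = a * moment b (a + b) (pcompose p [:1, 1:])"
    unfolding moment_def using assms by (intro suminf_mult summable_poly_meixner_weight) auto
  finally show ?thesis .
qed

lemma moment_raise:
  assumes "0 \<le> b" "b < 1" "0 \<le> a"
  shows "moment b a ([:a, b:] * p) = a * moment b (a + b) p"
proof -
  have "poly ([:a, b:] * p) (real x) * meixner_weight b a x =
      a * (poly p (real x) * meixner_weight b (a + b) x)" for x
    using arg_cong [OF meixner_weight_raise [of a b x], of "\<lambda>t. poly p (real x) * t"]
    by (simp add: algebra_simps)
  then have "moment b a ([:a, b:] * p) = (\<Sum>x. a * (poly p (real x) * meixner_weight b (a + b) x))"
    by (simp only: moment_def)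
  also have "\<dots> = a * moment b (a + b) p"
    unfolding moment_def using assms by (intro suminf_mult summable_poly_meixner_weight) auto
  finally show ?thesis .
qed

lemma moment_square_nonneg:
  assumes "0 \<le> b" "b < 1" "0 < a"
  shows "0 \<le> moment b a (p * p)"
  unfolding moment_def using assms meixner_weight_pos [OF assms(1,3)]
  by (intro suminf_nonneg summable_poly_meixner_weight mult_nonneg_nonneg) (auto simp: less_imp_le)

lemma moment_square_eq_0D:
  assumes "0 \<le> b" "b < 1" "0 < a" and "moment b a (p * p) = 0"
  shows "p = 0"
proof -
  have "poly (p * p) (real x) * meixner_weight b a x = 0" for x
    using suminf_eq_zero_iff [THEN iffD1, OF summable_poly_meixner_weight [of b a "p * p"]]
      assms meixner_weight_pos [OF assms(1,3)]
    by (auto simp: moment_def less_imp_le simp flip: power2_eq_square)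
  then have "poly p (real x) = 0" for x
    using meixner_weight_pos [OF assms(1,3)] by (metis less_irrefl mult_eq_0_iff poly_mult)
  then have "range real \<subseteq> {x. poly p x = 0}"
    by auto
  then have "infinite {x. poly p x = 0}"
    using finite_subset range_inj_infinite [OF inj_of_nat] by blast
  then show ?thesis
    using poly_roots_finite by blast
qed

lemma degree_difference_less:
  fixes q :: "real poly"
  assumes "degree q \<le> n"
  shows "pcompose q [:1, 1:] - q = 0 \<or> degree (pcompose q [:1, 1:] - q) < n"
proof (cases "degree q < n")
  case True
  then show ?thesis
    using degree_diff_le_max [of "pcompose q [:1, 1:]" q] by (simp add: degree_pcompose)
next
  case False
  then have n: "degree q = n"
    using assms by simp
  have "coeff (pcompose q [:1, 1:]) n = coeff q n"
    using lead_coeff_comp [of "[:1, 1:]" q] n by (simp add: degree_pcompose)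
  moreover have "degree (pcompose q [:1, 1:] - q) \<le> n"
    using degree_diff_le [of "pcompose q [:1, 1:]" n q] n by (simp add: degree_pcompose)
  ultimately show ?thesis
    by (intro eq_zero_or_degree_less) auto
qed

lemma pcompose_shift_inverse: "pcompose (pcompose p [:- 1, 1:]) [:1, 1:] = (p :: real poly)"
  by (simp add: pcompose_assoc [symmetric] pcompose_pCons)

text \<open>
  Summation by parts: the polynomial \<open>[:0, 1:]\<close> and the polynomial \<open>[:a, b:]\<close> both turn the weight for \<open>a\<close>
  into the weight for \<open>a + b\<close>, the first one with a shift of the argument.
\<close>

lemma moment_meixner_poly_Suc:
  assumes "0 \<le> b" "b < 1" "0 \<le> a"
  shows "(1 - b) * moment b a (meixner_poly b a (Suc n) * q) =
    a * moment b (a + b) (meixner_poly b (a + b) n * (pcompose q [:1, 1:] - q))"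
proof -
  define p where "p = meixner_poly b (a + b) n"
  have ab: "0 \<le> a + b"
    using assms by simp
  have "(1 - b) * moment b a (meixner_poly b a (Suc n) * q) =
      moment b a (smult (1 - b) (meixner_poly b a (Suc n)) * q)"
    by (simp add: moment_smult assms)
  also have "smult (1 - b) (meixner_poly b a (Suc n)) * q =
      [:0, 1:] * (pcompose p [:- 1, 1:] * q) - [:a, b:] * (p * q)"
    unfolding p_def using assms
    by (subst meixner_poly_raise) (auto simp: left_diff_distrib mult.assoc simp del: mult_pCons_left)
  also have "moment b a \<dots> = a * moment b (a + b) (p * pcompose q [:1, 1:]) - a * moment b (a + b) (p * q)"
    using assms by (simp only: moment_diff moment_shift moment_raise pcompose_mult pcompose_shift_inverse)
  also have "\<dots> = a * moment b (a + b) (p * (pcompose q [:1, 1:] - q))"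
    using assms ab by (simp add: moment_diff right_diff_distrib)
  finally show ?thesis
    unfolding p_def .
qed

text \<open>
  Each application of the previous identity lowers the degree of the test polynomial, which is
  annihilated after \<open>n\<close> steps.
\<close>

lemma moment_meixner_poly_orthogonal:
  assumes b: "0 \<le> b" "b < 1"
  shows "0 \<le> a \<Longrightarrow> q = 0 \<or> degree q < n \<Longrightarrow> moment b a (meixner_poly b a n * q) = 0"
proof (induction n arbitrary: a q)
  case (Suc n)
  have "pcompose q [:1, 1:] - q = 0 \<or> degree (pcompose q [:1, 1:] - q) < n"
    using Suc.prems(2) by (intro degree_difference_less) auto
  then have "moment b (a + b) (meixner_poly b (a + b) n * (pcompose q [:1, 1:] - q)) = 0"
    using b Suc.prems(1) by (intro Suc.IH) auto
  then have "(1 - b) * moment b a (meixner_poly b a (Suc n) * q) = 0"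
    using b Suc.prems(1) by (simp add: moment_meixner_poly_Suc)
  then show ?case
    using b by simp
qed auto

lemma degree_diff_less_monic:
  fixes p q :: "real poly"
  assumes "degree p = n" "degree q = n" "coeff p n = coeff q n"
  shows "p - q = 0 \<or> degree (p - q) < n"
  using assms by (intro eq_zero_or_degree_less degree_diff_le) auto

text \<open>
  Both sides are computed from the moment of \<open>x P\<^sub>n P\<^sub>n\<^sub>+\<^sub>1\<close>: it is the squared norm of \<open>P\<^sub>n\<^sub>+\<^sub>1\<close>, as
  \<open>x P\<^sub>n\<close> is monic of degree \<open>n + 1\<close>, and the three-term recurrence for \<open>x P\<^sub>n\<^sub>+\<^sub>1\<close> gives the other side.
\<close>

lemma moment_meixner_poly_square_Suc:
  assumes "0 \<le> b" "b < 1" "0 \<le> a"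
  shows "moment b a (meixner_poly b a (Suc n) * meixner_poly b a (Suc n)) =
    real (Suc n) * (a + b * real n) / (1 - b)\<^sup>2 *
    moment b a (meixner_poly b a n * meixner_poly b a n)"
proof -
  define P where "P = meixner_poly b a"
  define \<alpha> where "\<alpha> = (real (Suc n) * (1 + b) + a) / (1 - b)"
  define \<beta> where "\<beta> = real (Suc n) * (a + b * real n) / (1 - b)\<^sup>2"
  note orth = moment_meixner_poly_orthogonal [OF assms, folded P_def]
  have X: "[:0, 1:] * P (Suc n) = P (Suc (Suc n)) + smult \<alpha> (P (Suc n)) + smult \<beta> (P n)"
    unfolding P_def meixner_poly_three_term \<alpha>_def \<beta>_def by simp
  have "P (Suc n) - [:0, 1:] * P n = 0 \<or> degree (P (Suc n) - [:0, 1:] * P n) < Suc n"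
    unfolding P_def by (intro degree_diff_less_monic) (auto simp: degree_mult_eq)
  then have "moment b a (P (Suc n) * (P (Suc n) - [:0, 1:] * P n)) = 0"
    by (rule orth)
  then have "moment b a (P (Suc n) * P (Suc n)) = moment b a (([:0, 1:] * P (Suc n)) * P n)"
    by (simp add: moment_diff [OF assms] right_diff_distrib mult_ac del: mult_pCons_left mult_pCons_right)
  also have "\<dots> = moment b a (P (Suc (Suc n)) * P n) + \<alpha> * moment b a (P (Suc n) * P n)
      + \<beta> * moment b a (P n * P n)"
    unfolding X by (simp add: distrib_right moment_add [OF assms] moment_smult [OF assms])
  also have "moment b a (P (Suc (Suc n)) * P n) = 0"
    by (rule orth) (simp add: P_def)
  also have "moment b a (P (Suc n) * P n) = 0"
    by (rule orth) (simp add: P_def)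
  finally show ?thesis
    by (simp add: P_def \<beta>_def)
qed

text \<open>
  The right-hand side equals the left-hand side times the total mass of the weight, and this total
  mass is at least the weight \<open>1\<close> of the point \<open>0\<close>.
\<close>

lemma moment_meixner_poly_square_ge:
  assumes "0 \<le> b" "b < 1" "0 < a"
  shows "fact n * step_pochhammer b a n / (1 - b) ^ (2 * n) \<le>
    moment b a (meixner_poly b a n * meixner_poly b a n)"
proof (induction n)
  case 0
  have "(\<Sum>x<Suc 0. poly 1 (real x) * meixner_weight b a x) \<le> moment b a 1"
    unfolding moment_def using assms meixner_weight_pos [OF assms(1,3)]
    by (intro sum_le_suminf summable_poly_meixner_weight) (auto intro: less_imp_le)
  then show ?case
    by (simp add: meixner_poly_def meixner_weight_def)
next
  case (Suc n)
  define \<beta> where "\<beta> = real (Suc n) * (a + b * real n) / (1 - b)\<^sup>2"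
  have "0 \<le> \<beta>"
    using assms by (simp add: \<beta>_def)
  have "fact (Suc n) * step_pochhammer b a (Suc n) / (1 - b) ^ (2 * Suc n) =
      \<beta> * (fact n * step_pochhammer b a n / (1 - b) ^ (2 * n))"
    by (simp add: \<beta>_def step_pochhammer_Suc power2_eq_square mult_ac)
  also have "\<dots> \<le> \<beta> * moment b a (meixner_poly b a n * meixner_poly b a n)"
    using Suc.IH \<open>0 \<le> \<beta>\<close> by (rule mult_left_mono)
  also have "\<dots> = moment b a (meixner_poly b a (Suc n) * meixner_poly b a (Suc n))"
    using assms by (simp add: moment_meixner_poly_square_Suc \<beta>_def)
  finally show ?case .
qed

section \<open>Adding a mass at the origin\<close>

text \<open>
  Pairwise orthogonality is extended to all polynomials of smaller degree by successively subtracting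
  the multiple of \<open>C (degree q)\<close> that cancels the leading coefficient.
\<close>

lemma orthogonal_to_lower_degree:
  fixes C :: "nat \<Rightarrow> real poly" and L :: "real poly \<Rightarrow> real"
  assumes C: "\<And>n. degree (C n) = n" "\<And>n. coeff (C n) n = 1"
    and orth: "\<And>m n. m \<noteq> n \<Longrightarrow> L (C m * C n) = 0"
    and L: "\<And>p q. L (p + q) = L p + L q" "\<And>c p. L (smult c p) = c * L p"
  shows "q = 0 \<or> degree q < n \<Longrightarrow> L (C n * q) = 0"
proof (induction "degree q" arbitrary: q rule: less_induct)
  case less
  have L_0: "L 0 = 0"
    using L(2) [of 0 0] by simp
  show ?case
  proof (cases "q = 0")
    case False
    define r where "r = q - smult (lead_coeff q) (C (degree q))"
    have "degree r \<le> degree q"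
      unfolding r_def using C(1) by (intro degree_diff_le order_trans [OF degree_smult_le]) auto
    moreover have "coeff r (degree q) = 0"
      using C(2) by (simp add: r_def)
    ultimately have r: "r = 0 \<or> degree r < degree q"
      by (rule eq_zero_or_degree_less)
    have "L (C n * r) = 0"
    proof (cases "r = 0")
      case False
      then have "degree r < degree q"
        using r by simp
      then show ?thesis
        using less.hyps [of r] less.prems by (cases "q = 0") auto
    qed (simp add: L_0)
    moreover have "L (C n * C (degree q)) = 0"
      using less.prems False by (intro orth) auto
    moreover have "C n * q = C n * r + smult (lead_coeff q) (C n * C (degree q))"
      by (simp add: r_def right_diff_distrib)
    ultimately show ?thesis
      by (simp only: L mult_zero_right add_0)
  qed (simp add: L_0)
qed

text \<open>
  Up to a constant factor, the kernel polynomial of degree \<open>m\<close> at the point \<open>0\<close>.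
\<close>

definition shifted_kernel :: "real \<Rightarrow> real \<Rightarrow> nat \<Rightarrow> real poly"
  where "shifted_kernel b a m = pcompose (meixner_poly b (a + b) m) [:- 1, 1:]"

lemma degree_shifted_kernel [simp]: "degree (shifted_kernel b a m) = m"
  by (simp add: shifted_kernel_def degree_pcompose)

lemma coeff_shifted_kernel [simp]: "coeff (shifted_kernel b a m) m = 1"
  using lead_coeff_comp [of "[:- 1, 1:]" "meixner_poly b (a + b) m"]
  by (simp add: shifted_kernel_def degree_pcompose)

text \<open>
  Multiplied by \<open>x\<close>, the weight for \<open>a\<close> becomes the weight for \<open>a + b\<close> shifted by \<open>1\<close>.
\<close>

lemma moment_shifted_kernel_orthogonal:
  assumes "0 \<le> b" "b < 1" "0 \<le> a" and "q = 0 \<or> degree q < m"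
  shows "moment b a (shifted_kernel b a m * ([:0, 1:] * q)) = 0"
proof -
  have "moment b a (shifted_kernel b a m * ([:0, 1:] * q)) =
      moment b a ([:0, 1:] * (shifted_kernel b a m * q))"
    by (simp only: mult.left_commute)
  also have "\<dots> = a * moment b (a + b) (meixner_poly b (a + b) m * pcompose q [:1, 1:])"
    using assms(1-3) by (simp only: moment_shift shifted_kernel_def pcompose_mult pcompose_shift_inverse)
  also have "moment b (a + b) (meixner_poly b (a + b) m * pcompose q [:1, 1:]) = 0"
    using assms by (intro moment_meixner_poly_orthogonal) (auto simp: degree_pcompose)
  finally show ?thesis by simp
qed

lemma moment_shifted_kernel_reproducing:
  assumes "0 \<le> b" "b < 1" "0 \<le> a" and "degree q \<le> m"
  shows "moment b a (shifted_kernel b a m * q) = poly q 0 * moment b a (shifted_kernel b a m)"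
proof -
  obtain c r where q: "q = pCons c r"
    by (cases q)
  have r: "r = 0 \<or> degree r < m"
    using assms(4) by (auto simp: q split: if_splits)
  have "shifted_kernel b a m * q =
      smult c (shifted_kernel b a m) + shifted_kernel b a m * ([:0, 1:] * r)"
    by (simp add: q)
  then show ?thesis
    using moment_shifted_kernel_orthogonal [OF assms(1-3) r]
    by (simp only: moment_add moment_smult assms(1-3)) (simp add: q)
qed

text \<open>
  The difference of the classical and the modified polynomial of degree \<open>m + 1\<close> has degree at most \<open>m\<close>
  and is orthogonal to \<open>x r\<close> whenever \<open>r\<close> has degree less than \<open>m\<close>, hence is a multiple \<open>c S\<close> of the shifted kernel
  \<open>S\<close>. Orthogonality to \<open>1\<close> gives \<open>c (\<langle>S, 1\<rangle> + A S(0)) = A P\<^sub>m\<^sub>+\<^sub>1(0)\<close>. Here \<open>A S(0)\<close> does not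
  have the sign opposite to that of \<open>\<langle>S, 1\<rangle>\<close>, because \<open>S(0) \<langle>S, 1\<rangle> = \<langle>S, S\<rangle>\<close>, and
  \<open>\<langle>S, 1\<rangle> P\<^sub>m(0) = \<langle>P\<^sub>m, P\<^sub>m\<rangle>\<close>; so \<open>\<bar>c\<bar>\<close> is at most
  \<open>A \<bar>P\<^sub>m\<^sub>+\<^sub>1(0) P\<^sub>m(0)\<bar> / \<langle>P\<^sub>m, P\<^sub>m\<rangle>\<close>.
\<close>

lemma mass_modification:
  fixes C :: "nat \<Rightarrow> real poly"
  assumes b: "0 \<le> b" "b < 1" and a: "0 < a" and "0 \<le> A"
    and C: "monic_orthogonal (add_mass A (\<lambda>p q. moment b a (p * q))) C"
  obtains c where "C (Suc m) = meixner_poly b a (Suc m) - smult c (shifted_kernel b a m)"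
    and "\<bar>c\<bar> \<le> A / (1 - b) * (step_pochhammer b a (Suc m) / fact m)"
proof -
  define L where "L p = moment b a p + A * poly p 0" for p
  define S where "S = shifted_kernel b a m"
  define n where "n = Suc m"
  define P where "P = meixner_poly b a"
  define R where "R = P n - C n"
  define c where "c = coeff R m"
  have a0: "0 \<le> a" and ab: "0 < a + b"
    using a b by auto
  note moment_lin = moment_add [OF b a0] moment_diff [OF b a0] moment_smult [OF b a0]
  have C_deg: "degree (C k) = k" and C_coeff: "coeff (C k) k = 1" for k
    using C unfolding monic_orthogonal_def by metis+
  have C_orth: "L (C k * q) = 0" if "q = 0 \<or> degree q < k" for k q
  proof (rule orthogonal_to_lower_degree [OF C_deg C_coeff _ _ _ that])
    show "L (C i * C j) = 0" if "i \<noteq> j" for i j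
      using C that unfolding monic_orthogonal_def by (simp add: L_def add_mass_def mult.assoc)
  qed (simp_all add: L_def moment_lin algebra_simps)
  have R_deg: "R = 0 \<or> degree R < n"
    unfolding R_def P_def by (rule degree_diff_less_monic) (simp_all add: C_deg C_coeff)

  \<comment> \<open>The remainder \<open>U\<close> of the division by \<open>S\<close> satisfies \<open>\<langle>U, x U\<rangle> = 0\<close>, and \<open>x\<close> times the weight is
    positive at all positive integers.\<close>
  have "R - smult c S = 0"
  proof -
    define U where "U = R - smult c S"
    have "degree R \<le> m"
      using R_deg by (auto simp: n_def)
    moreover have "degree (smult c S) \<le> m"
      using degree_smult_le [of c S] by (simp add: S_def)
    ultimately have "degree U \<le> m"
      unfolding U_def by (rule degree_diff_le)
    moreover have "coeff U m = 0"
      by (simp add: U_def c_def S_def)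
    ultimately have U_deg: "U = 0 \<or> degree U < m"
      by (rule eq_zero_or_degree_less)
    then have XU_deg: "[:0, 1:] * U = 0 \<or> degree ([:0, 1:] * U) < n"
      by (auto simp: n_def)
    have "moment b a (P n * ([:0, 1:] * U)) = 0"
      unfolding P_def using XU_deg by (intro moment_meixner_poly_orthogonal b a0)
    moreover have "moment b a (C n * ([:0, 1:] * U)) = 0"
      using C_orth [OF XU_deg] by (simp add: L_def)
    ultimately have "moment b a (R * ([:0, 1:] * U)) = 0"
      by (simp only: R_def left_diff_distrib moment_lin)
    moreover have "moment b a (S * ([:0, 1:] * U)) = 0"
      unfolding S_def using b a0 U_deg by (rule moment_shifted_kernel_orthogonal)
    ultimately have "moment b a (U * ([:0, 1:] * U)) = 0"
      by (simp only: U_def left_diff_distrib moment_lin mult_smult_left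
          mult_zero_right diff_self)
    then have "a * moment b (a + b) (pcompose U [:1, 1:] * pcompose U [:1, 1:]) = 0"
      using moment_shift [OF b a0, of "U * U"] by (simp only: mult.left_commute pcompose_mult)
    then have "pcompose U [:1, 1:] = 0"
      using moment_square_eq_0D [OF b ab] a by auto
    then show ?thesis
      using pcompose_eq_0_iff [of "[:1, 1:]" U] by (simp add: U_def)
  qed
  then have Cn: "C n = P n - smult c S"
    by (simp add: R_def)

  have S_deg: "degree S = m" and Pm_deg: "degree (P m) = m"
    by (simp_all add: S_def P_def)
  have reproducing: "moment b a (S * q) = poly q 0 * moment b a S" if "degree q \<le> m" for q
    unfolding S_def using b a0 that by (rule moment_shifted_kernel_reproducing)
  have "L (C n * 1) = 0"
    by (rule C_orth) (simp add: n_def)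
  moreover have "moment b a (P n * 1) = 0"
    unfolding P_def by (rule moment_meixner_poly_orthogonal [OF b a0]) (simp add: n_def)
  ultimately have c_eq: "c * (moment b a S + A * poly S 0) = A * poly (P n) 0"
    by (simp add: L_def Cn moment_lin algebra_simps)
  have S_norm: "moment b a S * poly (P m) 0 = moment b a (P m * P m)"
  proof -
    have "S - P m = 0 \<or> degree (S - P m) < m"
      unfolding S_def P_def by (rule degree_diff_less_monic) simp_all
    then have "moment b a (P m * (S - P m)) = 0"
      unfolding P_def by (rule moment_meixner_poly_orthogonal [OF b a0])
    then have "moment b a (S * P m) = moment b a (P m * P m)"
      by (simp add: right_diff_distrib moment_lin mult.commute)
    then show ?thesis
      using reproducing [of "P m"] Pm_deg by (simp add: mult.commute)
  qed
  have "0 \<le> poly S 0 * moment b a S"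
    using moment_square_nonneg [OF b a, of S] reproducing [of S] S_deg by simp
  then have "0 \<le> A * (poly S 0 * moment b a S)"
    using \<open>0 \<le> A\<close> by simp
  moreover have "(moment b a S + A * poly S 0)\<^sup>2 =
      (moment b a S)\<^sup>2 + 2 * (A * (poly S 0 * moment b a S)) + (A * poly S 0)\<^sup>2"
    by (simp add: power2_eq_square algebra_simps)
  ultimately have "\<bar>moment b a S\<bar> \<le> \<bar>moment b a S + A * poly S 0\<bar>"
    using zero_le_power2 [of "A * poly S 0"] by (intro abs_le_square_iff [THEN iffD2]) linarith
  then have "\<bar>c\<bar> * \<bar>moment b a S\<bar> \<le> \<bar>A * poly (P n) 0\<bar>"
    unfolding c_eq [symmetric] abs_mult by (rule mult_left_mono) simp
  then have "\<bar>c\<bar> * \<bar>moment b a S\<bar> * \<bar>poly (P m) 0\<bar> \<le> A * \<bar>poly (P n) 0\<bar> * \<bar>poly (P m) 0\<bar>"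
    using \<open>0 \<le> A\<close> by (intro mult_right_mono) (auto simp: abs_mult)
  then have c_le: "\<bar>c\<bar> * moment b a (P m * P m) \<le> A * \<bar>poly (P n) 0\<bar> * \<bar>poly (P m) 0\<bar>"
    using S_norm moment_square_nonneg [OF b a, of "P m"] by (simp add: mult.assoc flip: abs_mult)

  define W where "W k = step_pochhammer b a k" for k
  have W_pos: "0 < W k" for k
    unfolding W_def step_pochhammer_def using b a by (intro prod_pos) (auto intro: add_pos_nonneg)
  have P_0: "\<bar>poly (P k) 0\<bar> = W k / (1 - b) ^ k" for k
  proof -
    have "(b - 1) ^ k * poly (P k) 0 = W k"
      using poly_meixner_poly [of b k a 0] b by (simp add: P_def W_def meixner_fun_at_0)
    then have "\<bar>b - 1\<bar> ^ k * \<bar>poly (P k) 0\<bar> = W k"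
      using W_pos [of k] by (metis abs_mult abs_of_pos power_abs)
    then show ?thesis
      using b by (simp add: field_simps)
  qed
  have "\<bar>c\<bar> * (fact m * W m / (1 - b) ^ (2 * m)) \<le> \<bar>c\<bar> * moment b a (P m * P m)"
    unfolding W_def P_def using moment_meixner_poly_square_ge [OF b a] by (intro mult_left_mono) auto
  also note c_le
  also have "A * \<bar>poly (P n) 0\<bar> * \<bar>poly (P m) 0\<bar> =
      A / (1 - b) * (W n / fact m) * (fact m * W m / (1 - b) ^ (2 * m))"
    unfolding P_0 n_def mult_2 power_add using b by (simp add: field_simps)
  finally have "\<bar>c\<bar> \<le> A / (1 - b) * (W n / fact m)"
    using b
    by (elim mult_right_le_imp_le) (simp add: W_pos)
  then show thesis
    using that [of c] Cn by (simp add: n_def P_def S_def W_def)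
qed

text \<open>
  The sequence is \<open>x\<close> times the weight at \<open>x = m + 1\<close>, a term of a convergent series.
\<close>

lemma mass_coefficient_tendsto_0:
  fixes a b :: real
  assumes "0 \<le> b" "b < 1" "0 \<le> a"
  shows "(\<lambda>m. step_pochhammer b a (Suc m) / fact m) \<longlonglongrightarrow> 0"
proof -
  have "(\<lambda>x. poly [:0, 1:] (real x) * meixner_weight b a x) \<longlonglongrightarrow> 0"
    using assms by (intro summable_LIMSEQ_zero summable_poly_meixner_weight)
  then have "(\<lambda>x. real (Suc x) * meixner_weight b a (Suc x)) \<longlonglongrightarrow> 0"
    by (subst (asm) filterlim_sequentially_Suc [symmetric]) simp
  then show ?thesis
    by (simp add: meixner_weight_def)
qed

definition scaling :: "real \<Rightarrow> nat \<Rightarrow> complex \<Rightarrow> complex"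
  where "scaling b n z = of_real (b - 1) ^ n * rGamma (of_nat n - z)"

lemma scaling_meixner_poly:
  assumes "b \<noteq> 1"
  shows "scaling b n z * cpoly (meixner_poly b a n) z = scaled_meixner b a n z"
  using cpoly_meixner_poly [OF assms, of n a z] by (simp add: scaling_def scaled_meixner_def mult_ac)

lemma scaling_Suc: "scaling b (Suc n) z = of_real (b - 1) * scaling b n (z - 1)"
  by (simp add: scaling_def algebra_simps)

text \<open>
  The scaled correction is \<open>c (b - 1)\<close>, which tends to \<open>0\<close>, times a scaled Meixner function at \<open>z - 1\<close>,
  which converges locally uniformly.
\<close>

lemma mass_modified_limit:
  fixes C :: "nat \<Rightarrow> real poly"
  assumes b: "0 \<le> b" "b < 1" and a: "0 < a" and A: "0 \<le> A"
    and C: "monic_orthogonal (add_mass A (\<lambda>p q. moment b a (p * q))) C"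
  shows "locally_uniform_limit (\<lambda>n z. scaling b n z * cpoly (C n) z)
    (\<lambda>z. limit_factor b a z * rGamma (- z))"
  unfolding locally_uniform_limit_def
proof (intro allI impI)
  fix K :: "complex set"
  assume K: "compact K"
  define l where "l a z = limit_factor b a z * rGamma (- z)" for a z
  have a0: "0 \<le> a" "0 \<le> a + b" and b1: "b \<noteq> 1"
    using a b by auto
  have "\<exists>c. C (Suc m) = meixner_poly b a (Suc m) - smult c (shifted_kernel b a m) \<and>
      \<bar>c\<bar> \<le> A / (1 - b) * (step_pochhammer b a (Suc m) / fact m)" for m
    using mass_modification [OF b a A C, of m] by metis
  then obtain c where c: "C (Suc m) = meixner_poly b a (Suc m) - smult (c m) (shifted_kernel b a m)"
    and c_le: "\<bar>c m\<bar> \<le> A / (1 - b) * (step_pochhammer b a (Suc m) / fact m)" for m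
    by metis
  have "(\<lambda>m. A / (1 - b) * (step_pochhammer b a (Suc m) / fact m)) \<longlonglongrightarrow> A / (1 - b) * 0"
    by (intro tendsto_intros mass_coefficient_tendsto_0 b a0)
  then have "c \<longlonglongrightarrow> 0"
    using c_le by (intro Lim_null_comparison [of c]) (auto simp: always_eventually)
  then have "(\<lambda>m. complex_of_real (c m) * of_real (b - 1)) \<longlonglongrightarrow> of_real 0 * of_real (b - 1)"
    by (intro tendsto_intros)
  then have "(\<lambda>m. norm (complex_of_real (c m) * of_real (b - 1))) \<longlonglongrightarrow> 0"
    by (intro tendsto_norm_zero) simp
  then have coeff: "uniform_limit K (\<lambda>m z. complex_of_real (c m) * of_real (b - 1)) (\<lambda>z. 0) sequentially"
    by (rule uniform_limit_norm_diff_le [rotated]) simp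
  have "scaling b (Suc m) z * cpoly (C (Suc m)) z =
      scaled_meixner b a (Suc m) z - of_real (c m) * of_real (b - 1) * scaled_meixner b (a + b) m (z + (- 1))"
    for m z
  proof -
    have "scaling b (Suc m) z * cpoly (shifted_kernel b a m) z =
        of_real (b - 1) * scaled_meixner b (a + b) m (z - 1)"
      unfolding shifted_kernel_def cpoly_translate scaling_Suc
      using scaling_meixner_poly [OF b1, of m "z - 1" "a + b"] by (simp add: mult.assoc)
    then show ?thesis
      unfolding c cpoly_diff cpoly_smult right_diff_distrib scaling_meixner_poly [OF b1]
      by (simp add: mult_ac del: of_real_diff of_real_add)
  qed
  moreover have "uniform_limit K (\<lambda>m z. scaled_meixner b a (Suc m) z
      - of_real (c m) * of_real (b - 1) * scaled_meixner b (a + b) m (z + (- 1)))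
    (\<lambda>z. l a z - 0 * l (a + b) (z + (- 1))) sequentially"
  proof (intro uniform_limit_minus uniform_limit_mult_compact [OF K] coeff)
    have "uniform_limit K (scaled_meixner b a) (l a) sequentially"
      using scaled_meixner_limit [OF b a0(1)] K unfolding l_def locally_uniform_limit_def by blast
    then show "uniform_limit K (\<lambda>m. scaled_meixner b a (Suc m)) (l a) sequentially"
      by (subst filterlim_sequentially_Suc [of "scaled_meixner b a"])
    show "uniform_limit K (\<lambda>m z. scaled_meixner b (a + b) m (z + (- 1)))
        (\<lambda>z. l (a + b) (z + (- 1))) sequentially"
      using uniform_limit_translate [OF scaled_meixner_limit [OF b a0(2)] K, of "- 1"]
      unfolding l_def .
    show "continuous_on K (\<lambda>z. l (a + b) (z + (- 1)))"
      unfolding l_def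
      by (rule continuous_on_compose2 [OF continuous_on_limit [of UNIV]]) (auto intro: continuous_intros)
  qed (rule continuous_on_const)
  ultimately have "uniform_limit K (\<lambda>m z. scaling b (Suc m) z * cpoly (C (Suc m)) z) (l a) sequentially"
    by simp
  then show "uniform_limit K (\<lambda>n z. scaling b n z * cpoly (C n) z)
      (\<lambda>z. limit_factor b a z * rGamma (- z)) sequentially"
    unfolding l_def
    by (subst (asm) filterlim_sequentially_Suc [of "\<lambda>n z. scaling b n z * cpoly (C n) z"])
qed

lemma monic_orthogonal_add_mass_scaled:
  assumes "d \<noteq> 0" and B: "\<And>p q. B p q = d * B' p q"
    and "monic_orthogonal (add_mass A B) C"
  shows "monic_orthogonal (add_mass (A / d) B') C"
proof -
  have "add_mass A B p q = d * add_mass (A / d) B' p q" for p q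
    using assms(1) by (simp add: add_mass_def B algebra_simps)
  then have "add_mass (A / d) B' p q = 0" if "add_mass A B p q = 0" for p q
    using that assms(1) by simp
  then show ?thesis
    using assms(3) unfolding monic_orthogonal_def by blast
qed

section \<open>Limits of forward differences\<close>

text \<open>
  The argument uses the scaling factor alone and applies to arbitrary functions; hence it can be iterated.
\<close>

lemma scaled_forward_diff_limit:
  assumes lim: "locally_uniform_limit (\<lambda>n z. scaling b n z * f n z) l" and l: "continuous_on UNIV l"
  shows "locally_uniform_limit (\<lambda>n z. scaling b n z * forward_diff (f n) z) (\<lambda>z. - l z)"
  unfolding locally_uniform_limit_def
proof (intro allI impI)
  fix K :: "complex set"
  assume K: "compact K"
  define F where "F n z = scaling b n z * f n z" for n z
  have K1: "compact ((\<lambda>z. z + 1) ` K)"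
    using K by (intro compact_continuous_image continuous_intros)
  have inverse: "uniform_limit K (\<lambda>n z. 1 / (of_nat n - (z + 1))) (\<lambda>z. 0) sequentially"
    using uniform_limit_inverse_shift [OF K1] by (rule uniform_limit_compose') auto
  have l1: "continuous_on K (\<lambda>z. l (z + 1))"
    by (rule continuous_on_compose2 [OF l]) (auto intro: continuous_intros)
  have "uniform_limit K F l sequentially"
    using lim K unfolding F_def locally_uniform_limit_def by blast
  moreover have "uniform_limit K (\<lambda>n z. F n (z + 1)) (\<lambda>z. l (z + 1)) sequentially"
    unfolding F_def using lim K by (rule uniform_limit_translate)
  ultimately have "uniform_limit K (\<lambda>n z. 1 / (of_nat n - (z + 1)) * F n (z + 1) - F n z)
      (\<lambda>z. 0 * l (z + 1) - l z) sequentially"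
    by (intro uniform_limit_minus uniform_limit_mult_compact [OF K continuous_on_const l1 inverse])
  moreover have "\<forall>\<^sub>F n in sequentially. \<forall>z\<in>K.
      1 / (of_nat n - (z + 1)) * F n (z + 1) - F n z = scaling b n z * forward_diff (f n) z"
    using eventually_of_nat_avoids_compact [OF K1]
  proof eventually_elim
    case (elim n)
    show ?case
    proof
      fix z
      assume "z \<in> K"
      with elim have "of_nat n - (z + 1) \<noteq> 0"
        by auto
      moreover have "scaling b n (z + 1) = (of_nat n - (z + 1)) * scaling b n z"
        using rGamma_plus1 [of "of_nat n - (z + 1)"] by (simp add: scaling_def mult_ac)
      ultimately have "1 / (of_nat n - (z + 1)) * F n (z + 1) = scaling b n z * f n (z + 1)"
        by (simp add: F_def)
      then show "1 / (of_nat n - (z + 1)) * F n (z + 1) - F n z = scaling b n z * forward_diff (f n) z"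
        by (simp add: F_def forward_diff_def right_diff_distrib)
    qed
  qed
  ultimately show "uniform_limit K (\<lambda>n z. scaling b n z * forward_diff (f n) z) (\<lambda>z. - l z) sequentially"
    by (rule uniform_limit_transform_eventually) simp
qed

lemma scaled_iterated_forward_diff_limit:
  assumes "locally_uniform_limit (\<lambda>n z. scaling b n z * f n z) l" and l: "continuous_on UNIV l"
  shows "locally_uniform_limit (\<lambda>n z. scaling b n z * (forward_diff ^^ k) (f n) z) (\<lambda>z. (- 1) ^ k * l z)"
proof (induction k)
  case 0
  then show ?case
    using assms(1) by simp
next
  case (Suc k)
  show ?case
    using scaled_forward_diff_limit [OF Suc.IH] l by (simp add: continuous_on_mult)
qed

section \<open>Charlier and Meixner polynomials\<close>

lemma charlier_inner_eq_moment:
  assumes "0 \<le> \<mu>"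
  shows "charlier_inner \<mu> p q = exp (- \<mu>) * moment 0 \<mu> (p * q)"
proof -
  have "meixner_weight 0 \<mu> x = \<mu> ^ x / fact x" for x
    by (simp add: meixner_weight_def step_pochhammer_def)
  then have "charlier_inner \<mu> p q =
      (\<Sum>x. exp (- \<mu>) * (poly (p * q) (real x) * meixner_weight 0 \<mu> x))"
    by (simp add: charlier_inner_def mult_ac)
  also have "\<dots> = exp (- \<mu>) * moment 0 \<mu> (p * q)"
    unfolding moment_def using assms by (intro suminf_mult summable_poly_meixner_weight) auto
  finally show ?thesis .
qed

lemma meixner_inner_eq_moment: "meixner_inner \<gamma> \<mu> p q = moment \<mu> (\<mu> * \<gamma>) (p * q)"
proof -
  have "meixner_weight \<mu> (\<mu> * \<gamma>) x = pochhammer \<gamma> x * \<mu> ^ x / fact x" for x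
  proof -
    have "\<mu> * \<gamma> + \<mu> * real j = (\<gamma> + real j) * \<mu>" for j
      by (simp add: algebra_simps)
    then show ?thesis
      by (simp add: meixner_weight_def step_pochhammer_def pochhammer_prod atLeast0LessThan prod.distrib)
  qed
  then show ?thesis
    by (simp add: meixner_inner_def moment_def mult_ac)
qed

lemma charlier_theta_eq_scaling: "charlier_theta = scaling 0"
  by (intro ext) (simp add: charlier_theta_def scaling_def)

lemma meixner_theta_eq_scaling: "meixner_theta = scaling"
  by (intro ext) (simp add: meixner_theta_def scaling_def)

lemma charlier_phi_eq: "charlier_phi \<mu> = (\<lambda>z. limit_factor 0 \<mu> z * rGamma (- z))"
  by (rule ext) (simp add: charlier_phi_def limit_factor_def exp_of_real)

lemma meixner_phi_eq:
  assumes "\<mu> \<noteq> 0"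
  shows "meixner_phi \<gamma> \<mu> = (\<lambda>z. limit_factor \<mu> (\<mu> * \<gamma>) z * rGamma (- z))"
proof
  fix z
  have "of_real (\<mu> * \<gamma> / \<mu>) = complex_of_real \<gamma>"
    using assms by simp
  then show "meixner_phi \<gamma> \<mu> z = limit_factor \<mu> (\<mu> * \<gamma>) z * rGamma (- z)"
    using assms unfolding meixner_phi_def limit_factor_def
    by (simp only: if_False mult_minus_left exp_minus divide_inverse mult.commute)
qed

theorem theorem4p1:
  fixes k :: nat and A :: real
  assumes "A \<ge> 0"
  shows
    "(\<forall>\<mu>::real. \<mu> > 0 \<longrightarrow>
        (\<forall>C. monic_orthogonal (add_mass A (charlier_inner \<mu>)) C \<longrightarrow>
           locally_uniform_limit
             (\<lambda>n z. charlier_theta n z * (forward_diff ^^ k) (cpoly (C n)) z)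
             (\<lambda>z. (-1) ^ k * charlier_phi \<mu> z) \<and>
           locally_uniform_limit
             (\<lambda>n z. charlier_theta n z * cpoly (C n) z) (charlier_phi \<mu>)) \<and>
        locally_uniform_limit
          (\<lambda>n z. charlier_theta n z * cpoly (charlier \<mu> n) z) (charlier_phi \<mu>)) \<and>
     (\<forall>\<gamma> \<mu>::real. \<gamma> > 0 \<and> 0 < \<mu> \<and> \<mu> < 1 \<longrightarrow>
        (\<forall>M. monic_orthogonal (add_mass A (meixner_inner \<gamma> \<mu>)) M \<longrightarrow>
           locally_uniform_limit
             (\<lambda>n z. meixner_theta \<mu> n z * (forward_diff ^^ k) (cpoly (M n)) z)
             (\<lambda>z. (-1) ^ k * meixner_phi \<gamma> \<mu> z) \<and>
           locally_uniform_limit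
             (\<lambda>n z. meixner_theta \<mu> n z * cpoly (M n) z) (meixner_phi \<gamma> \<mu>)) \<and>
        locally_uniform_limit
          (\<lambda>n z. meixner_theta \<mu> n z * cpoly (meixner \<gamma> \<mu> n) z) (meixner_phi \<gamma> \<mu>))"
proof (intro conjI allI impI)
  fix \<mu> :: real and C
  assume \<mu>: "\<mu> > 0" and "monic_orthogonal (add_mass A (charlier_inner \<mu>)) C"
  then have "monic_orthogonal (add_mass (A / exp (- \<mu>)) (\<lambda>p q. moment 0 \<mu> (p * q))) C"
    by (intro monic_orthogonal_add_mass_scaled [of "exp (- \<mu>)" "charlier_inner \<mu>"])
      (auto simp: charlier_inner_eq_moment)
  then show *: "locally_uniform_limit (\<lambda>n z. charlier_theta n z * cpoly (C n) z) (charlier_phi \<mu>)"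
    unfolding charlier_theta_eq_scaling charlier_phi_eq
    using \<mu> assms by (intro mass_modified_limit) auto
  show "locally_uniform_limit
      (\<lambda>n z. charlier_theta n z * (forward_diff ^^ k) (cpoly (C n)) z)
      (\<lambda>z. (-1) ^ k * charlier_phi \<mu> z)"
    using * continuous_on_limit unfolding charlier_theta_eq_scaling charlier_phi_eq
    by (rule scaled_iterated_forward_diff_limit)
next
  fix \<mu> :: real
  assume "\<mu> > 0"
  then show "locally_uniform_limit (\<lambda>n z. charlier_theta n z * cpoly (charlier \<mu> n) z) (charlier_phi \<mu>)"
    unfolding charlier_theta_eq_scaling charlier_phi_eq charlier_eq_meixner_poly
    using scaled_meixner_limit [of 0 \<mu>] by (simp add: scaling_meixner_poly)
next
  fix \<gamma> \<mu> :: real and M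
  assume par: "\<gamma> > 0 \<and> 0 < \<mu> \<and> \<mu> < 1" and M: "monic_orthogonal (add_mass A (meixner_inner \<gamma> \<mu>)) M"
  from par have phi: "meixner_phi \<gamma> \<mu> = (\<lambda>z. limit_factor \<mu> (\<mu> * \<gamma>) z * rGamma (- z))"
    by (intro meixner_phi_eq) auto
  from M have "monic_orthogonal (add_mass A (\<lambda>p q. moment \<mu> (\<mu> * \<gamma>) (p * q))) M"
    using monic_orthogonal_add_mass_scaled
      [of 1 "meixner_inner \<gamma> \<mu>" "\<lambda>p q. moment \<mu> (\<mu> * \<gamma>) (p * q)" A M]
    by (simp add: meixner_inner_eq_moment)
  then show *: "locally_uniform_limit (\<lambda>n z. meixner_theta \<mu> n z * cpoly (M n) z) (meixner_phi \<gamma> \<mu>)"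
    unfolding meixner_theta_eq_scaling phi
    using par assms by (intro mass_modified_limit) auto
  show "locally_uniform_limit
      (\<lambda>n z. meixner_theta \<mu> n z * (forward_diff ^^ k) (cpoly (M n)) z)
      (\<lambda>z. (-1) ^ k * meixner_phi \<gamma> \<mu> z)"
    using * continuous_on_limit
    unfolding meixner_theta_eq_scaling phi
    by (rule scaled_iterated_forward_diff_limit)
next
  fix \<gamma> \<mu> :: real
  assume par: "\<gamma> > 0 \<and> 0 < \<mu> \<and> \<mu> < 1"
  then have "meixner_phi \<gamma> \<mu> = (\<lambda>z. limit_factor \<mu> (\<mu> * \<gamma>) z * rGamma (- z))"
    by (intro meixner_phi_eq) auto
  then show "locally_uniform_limit (\<lambda>n z. meixner_theta \<mu> n z * cpoly (meixner \<gamma> \<mu> n) z) (meixner_phi \<gamma> \<mu>)"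
    unfolding meixner_theta_eq_scaling meixner_eq_meixner_poly
    using scaled_meixner_limit [of \<mu> "\<mu> * \<gamma>"] par by (simp add: scaling_meixner_poly)
qed

end
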